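(* Let $1<p<+\infty$, $\omega\in\mathbb R$, and $Y\in\mathbb E_2$ with $Y\neq0$. There does not exist a set $\mathcal X$, compact in $L^p(\mathbb S^2)$, with $\varnothing\neq\mathcal X\subsetneqq\mathcal O^+_{Y}$, having the following property: for any $\varepsilon>0$ there exists $\delta>0$ such that for any smooth solution $\zeta$ of the vorticity equation $(V_\omega)$, $$\min_{f\in \mathcal X}\|f-\zeta_0\|_{L^p(\mathbb S^2)}<\delta\quad\Longrightarrow\quad \min_{f\in \mathcal X}\|f-\zeta_t\|_{L^p(\mathbb S^2)}<\varepsilon\quad\forall\,t>0.$$
   Context: $\mathbb S^2$ is the unit sphere in $\mathbb R^3$ with the standard metric and area measure $\sigma$, with spherical coordinates $(\varphi,\theta)\mapsto(\cos\theta\cos\varphi,\cos\theta\sin\varphi,\sin\theta)$; thus $\sin\theta=x_3$. All functions are real-valued. $\mathring L^p(\mathbb S^2)$ is the space of $L^p$ functions with zero mean. For $1<r<\infty$ and $f\in\mathring L^r(\mathbb S^2)$, $\mathcal Gf$ is the unique zero-mean function in $W^{2,r}(\mathbb S^2)$ with $-\Delta(\mathcal Gf)=f$ ($\Delta$ the Laplace-Beltrami operator). $J$ is the anticlockwise rotation by $\pi/2$ in the tangent planes, i.e. $J\mathbf v=\mathbf x\times\mathbf v$ at $\mathbf x\in\mathbb S^2$; in coordinates $J\nabla f=-\partial_\theta f\,\mathbf e_\varphi+\frac1{\cos\theta}\partial_\varphi f\,\mathbf e_\theta$. For a fixed rotation speed $\omega\in\mathbb R$, the vorticity equation $(V_\omega)$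 for the absolute vorticity $\zeta$ is $$\partial_t\zeta+J\nabla(\omega\sin\theta-\mathcal G\zeta)\cdot\nabla\zeta=0\quad\text{on }\mathbb S^2,\ t>0.$$ A smooth solution is a smooth function $\zeta$ on $\mathbb S^2\times[0,\infty)$, of zero mean on $\mathbb S^2$ at each time, satisfying this equation; $\zeta_t:=\zeta(\cdot,t)$. $\mathbb E_2$ is the space of real functions $Y$ on $\mathbb S^2$ with $-\Delta Y=6Y$. For $f:\mathbb S^2\to\mathbb R$, $\mathcal O^+_f=\{f\circ\mathsf g\mid\mathsf g\in\mathbf{SO}(3)\}$. *)

theory Defs
  imports "HOL-Analysis.Analysis"
begin

section \<open>Smooth functions\<close>

text \<open>Meant for open \<open>U\<close>.\<close>

primrec C_k_on :: "nat \<Rightarrow> ('a::euclidean_space \<Rightarrow> real) \<Rightarrow> 'a set \<Rightarrow> bool" where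
  "C_k_on 0 f U \<longleftrightarrow> continuous_on U f"
| "C_k_on (Suc k) f U \<longleftrightarrow> f differentiable_on U \<and>
     (\<forall>b\<in>Basis. C_k_on k (\<lambda>x. frechet_derivative f (at x) b) U)"

text \<open>Smoothness on a subset such as the sphere, or the sphere times a closed half-line,
  is the existence of a smooth extension to a neighbourhood.\<close>

definition smooth_on :: "'a::euclidean_space set \<Rightarrow> ('a \<Rightarrow> real) \<Rightarrow> bool" where
  "smooth_on A f \<longleftrightarrow> (\<exists>U F. open U \<and> A \<subseteq> U \<and> (\<forall>k. C_k_on k F U) \<and> (\<forall>x\<in>A. F x = f x))"


section \<open>The unit sphere and its area measure\<close>

abbreviation S2 :: "(real^3) set" where
  "S2 \<equiv> sphere 0 1"

definition sph_coords :: "real \<times> real \<Rightarrow> real^3" where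
  "sph_coords = (\<lambda>(\<phi>, \<theta>). vector [cos \<theta> * cos \<phi>, cos \<theta> * sin \<phi>, sin \<theta>])"

text \<open>The area element is \<open>cos \<theta> d\<phi> d\<theta>\<close>; the doubly covered meridian is a null set.\<close>

definition area_measure :: "(real^3) measure" where
  "area_measure =
     distr (density (restrict_space lborel ({-pi..pi} \<times> {-pi/2..pi/2})) (\<lambda>(\<phi>, \<theta>). ennreal (cos \<theta>)))
           (restrict_space borel S2) sph_coords"

definition zero_mean :: "(real^3 \<Rightarrow> real) \<Rightarrow> bool" where
  "zero_mean f \<longleftrightarrow> (\<integral>x. f x \<partial>area_measure) = 0"


section \<open>\<open>L\<^sup>p\<close> spaces on the sphere\<close>

definition Lp :: "real \<Rightarrow> (real^3 \<Rightarrow> real) set" where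
  "Lp p = {f \<in> borel_measurable area_measure. integrable area_measure (\<lambda>x. \<bar>f x\<bar> powr p)}"

definition Lp_norm :: "real \<Rightarrow> (real^3 \<Rightarrow> real) \<Rightarrow> real" where
  "Lp_norm p f = (\<integral>x. \<bar>f x\<bar> powr p \<partial>area_measure) powr (1 / p)"

text \<open>Functions are not identified up to null sets, so this topology is only pseudometrizable.
  A set of functions is compact in it iff its set of almost-everywhere classes is compact
  in the usual metric space.\<close>

definition Lp_topology :: "real \<Rightarrow> (real^3 \<Rightarrow> real) topology" where
  "Lp_topology p =
     topology_generated_by {{h \<in> Lp p. Lp_norm p (\<lambda>x. h x - f x) < \<epsilon>} | f \<epsilon>. f \<in> Lp p}"

text \<open>If \<open>X\<close> is nonempty and compact, the infimum is a minimum.\<close>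

definition Lp_dist :: "real \<Rightarrow> (real^3 \<Rightarrow> real) set \<Rightarrow> (real^3 \<Rightarrow> real) \<Rightarrow> real" where
  "Lp_dist p X h = (INF f\<in>X. Lp_norm p (\<lambda>x. f x - h x))"


section \<open>Differential operators\<close>

text \<open>The tangential gradient is the Euclidean gradient of the extension that is constant along
  rays; it depends only on the values of \<open>f\<close> on the sphere and is orthogonal to \<open>x\<close>.\<close>

definition grad :: "(real^3 \<Rightarrow> real) \<Rightarrow> real^3 \<Rightarrow> real^3" where
  "grad f x = (\<chi> i. frechet_derivative (\<lambda>y. f (y /\<^sub>R norm y)) (at x) (axis i 1))"

text \<open>On tangent fields this is the Riemannian divergence: the trace of the tangential derivative
  is not affected by projecting the derivative to the tangent plane.\<close>

definition divergence :: "(real^3 \<Rightarrow> real^3) \<Rightarrow> real^3 \<Rightarrow> real" where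
  "divergence V x = (\<Sum>i\<in>UNIV. grad (\<lambda>y. V y $ i) x $ i)"

definition laplace_beltrami :: "(real^3 \<Rightarrow> real) \<Rightarrow> real^3 \<Rightarrow> real" where
  "laplace_beltrami f = divergence (grad f)"

definition J :: "real^3 \<Rightarrow> real^3 \<Rightarrow> real^3" where
  "J x v = cross3 x v"


section \<open>The Sobolev space \<open>W\<^sup>2\<^sup>,\<^sup>r\<close> and the inverse Laplacian\<close>

text \<open>The iterated tangential derivatives differ from the components of the covariant Hessian
  only by first-order terms, so this is equivalent to the usual norm.\<close>

definition sobolev2_norm :: "real \<Rightarrow> (real^3 \<Rightarrow> real) \<Rightarrow> real" where
  "sobolev2_norm r v = Lp_norm r v + Lp_norm r (\<lambda>x. norm (grad v x))
     + (\<Sum>i\<in>UNIV. Lp_norm r (\<lambda>x. norm (grad (\<lambda>y. grad v y $ i) x)))"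

text \<open>The completion of the smooth functions, realized inside \<open>L\<^sup>r\<close>.\<close>

definition sobolev2 :: "real \<Rightarrow> (real^3 \<Rightarrow> real) set" where
  "sobolev2 r = {u \<in> Lp r. \<exists>v::nat \<Rightarrow> real^3 \<Rightarrow> real.
     (\<forall>n. smooth_on S2 (v n)) \<and>
     (\<forall>\<epsilon>>0. \<exists>N. \<forall>m\<ge>N. \<forall>n\<ge>N. sobolev2_norm r (\<lambda>x. v m x - v n x) < \<epsilon>) \<and>
     (\<lambda>n. Lp_norm r (\<lambda>x. v n x - u x)) \<longlonglongrightarrow> 0}"

text \<open>The equation \<open>-\<Delta>u = f\<close> in the sense of distributions.\<close>

definition weak_poisson :: "(real^3 \<Rightarrow> real) \<Rightarrow> (real^3 \<Rightarrow> real) \<Rightarrow> bool" where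
  "weak_poisson u f \<longleftrightarrow> (\<forall>\<phi>. smooth_on S2 \<phi> \<longrightarrow>
     - (\<integral>x. u x * laplace_beltrami \<phi> x \<partial>area_measure) = (\<integral>x. f x * \<phi> x \<partial>area_measure))"

text \<open>For zero-mean \<open>f \<in> L\<^sup>r\<close>, \<open>1 < r < \<infinity>\<close>. As \<open>W\<^sup>2\<^sup>,\<^sup>r\<close> embeds into the continuous functions,
  the solution, a priori an almost-everywhere class, is represented by its continuous member. The
  solution does not depend on the choice of \<open>r\<close>. Extensionality fixes the irrelevant values off
  the sphere.\<close>

definition \<G> :: "(real^3 \<Rightarrow> real) \<Rightarrow> real^3 \<Rightarrow> real" where
  "\<G> f = (THE u. u \<in> extensional S2 \<and> continuous_on S2 u \<and> zero_mean u \<and>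
     (\<exists>r>1. f \<in> Lp r \<and> u \<in> sobolev2 r \<and> weak_poisson u f))"


section \<open>The vorticity equation\<close>

definition smooth_solution :: "real \<Rightarrow> (real \<Rightarrow> real^3 \<Rightarrow> real) \<Rightarrow> bool" where
  "smooth_solution \<omega> \<zeta> \<longleftrightarrow>
     smooth_on (S2 \<times> {0..}) (\<lambda>(x, t). \<zeta> t x) \<and>
     (\<forall>t\<ge>0. zero_mean (\<zeta> t)) \<and>
     (\<forall>t>0. \<forall>x\<in>S2. deriv (\<lambda>s. \<zeta> s x) t
        + J x (grad (\<lambda>y. \<omega> * y $ 3 - \<G> (\<zeta> t) y) x) \<bullet> grad (\<zeta> t) x = 0)"


section \<open>The second eigenspace and rotation orbits\<close>

text \<open>Functions on the sphere are represented by extensional functions, so that equality of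
  functions, and hence inclusion between sets of functions, has its usual meaning.\<close>

definition E2 :: "(real^3 \<Rightarrow> real) set" where
  "E2 = {Y \<in> extensional S2. smooth_on S2 Y \<and> (\<forall>x\<in>S2. - laplace_beltrami Y x = 6 * Y x)}"

definition SO3_orbit :: "(real^3 \<Rightarrow> real) \<Rightarrow> (real^3 \<Rightarrow> real) set" where
  "SO3_orbit f = {(\<lambda>x\<in>S2. f (A *v x)) | A :: real^3^3. rotation_matrix A}"

end

theory Submission
  imports Defs
begin

text \<open>
  If \<open>\<zeta> = L + Q\<close> with \<open>L\<close> linear and \<open>Q\<close> in the second eigenspace, then \<open>\<G> \<zeta> = L/2 + Q/6\<close>, and the
  vorticity equation splits: \<open>L\<close> rotates about the third axis with angular velocity \<open>\<omega>\<close>, while \<open>Q\<close> is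
  carried by the same rotation composed with a rotation about the axis of \<open>L\<close> whose speed is
  proportional to the size of \<open>L\<close>. An arbitrarily small linear perturbation of \<open>f \<in> X\<close> therefore turns
  \<open>f\<close>, after a long time chosen as a multiple of the period of the first rotation, by any prescribed
  angle about any prescribed axis. Hence a stable compact set is invariant under all rotations and
  equals the whole orbit.

  On the sphere \<open>\<Delta>\<close> is the sum of the squares of the three rotation generators, and the area integral
  of such a derivative vanishes; this gives Green's formula, hence \<open>\<G>\<close> on eigenfunctions. Uniqueness
  in the definition of \<open>\<G>\<close> follows by testing with the powers of \<open>a \<bullet> x\<close>.
\<close>

section \<open>Calculus of $C^k$ functions\<close>

text \<open>The nonlinear term is a bracket of stream function and vorticity. On each eigenspace
  \<open>\<G>\<close> is a scalar, so L and Q have no bracket with themselves; only the mixed one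
  survives, with coefficient 1/2 - 1/6 = 1/3, the gap between the two inverse eigenvalues. This is
  the source of the 3 in the rotation speeds. Since L is linear, its bracket with Q is an
  infinitesimal rotation, which preserves the eigenspace of Q; so the ansatz closes and the solution
  is explicit for all times. The obstacle is evaluating \<open>\<G>\<close>, a definite description
  over continuous weak solutions. A competitor has too little regularity for Green's formula as
  proved here, so every derivative has to fall on a smooth test function. Stability gives, for each
  \<epsilon>, only some member of X near the rotated f, because the linear perturbation tends to
  zero without vanishing. Compactness turns this approximation into membership.\<close>

lemma C_k_on_cong:
  assumes "open U"
  shows "C_k_on k f U \<Longrightarrow> (\<And>x. x \<in> U \<Longrightarrow> f x = g x) \<Longrightarrow> C_k_on k g U"
proof (induction k arbitrary: f g)
  case 0
  then show ?case by (metis C_k_on.simps(1) continuous_on_cong)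
next
  case (Suc k)
  have f': "f differentiable at x" if "x \<in> U" for x
    using Suc.prems(1) that assms by (simp add: differentiable_on_eq_differentiable_at)
  have g': "(g has_derivative frechet_derivative f (at x)) (at x)" if x: "x \<in> U" for x
  proof (rule has_derivative_transform_within_open[OF _ assms x])
    show "(f has_derivative frechet_derivative f (at x)) (at x)"
      using f'[OF x] by (simp add: frechet_derivative_works)
  qed (rule Suc.prems(2))
  then have "g differentiable_on U"
    by (meson differentiable_at_imp_differentiable_on differentiable_def)
  moreover have "C_k_on k (\<lambda>x. frechet_derivative g (at x) b) U" if b: "b \<in> Basis" for b
  proof (rule Suc.IH)
    show "C_k_on k (\<lambda>x. frechet_derivative f (at x) b) U"
      using Suc.prems(1) b by simp
    show "frechet_derivative f (at x) b = frechet_derivative g (at x) b" if "x \<in> U" for x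
      using frechet_derivative_at[OF g'[OF that]] by simp
  qed
  ultimately show ?case by simp
qed

text \<open>\<open>C_k_on\<close> is phrased with the choice operator
  \<open>frechet_derivative\<close>. Uniqueness of derivatives at the points of an open set lets any
  explicit formula take its place.\<close>

lemma C_k_on_SucI:
  assumes "open U" "\<And>x. x \<in> U \<Longrightarrow> (f has_derivative f' x) (at x)"
    and "\<And>b. b \<in> Basis \<Longrightarrow> C_k_on k (\<lambda>x. f' x b) U"
  shows "C_k_on (Suc k) f U"
proof -
  have "f differentiable_on U"
    using assms(2) by (meson differentiable_at_imp_differentiable_on differentiable_def)
  moreover have f': "frechet_derivative f (at x) = f' x" if "x \<in> U" for x
    using frechet_derivative_at[OF assms(2)[OF that]] by simp
  moreover have "C_k_on k (\<lambda>x. frechet_derivative f (at x) b) U" if "b \<in> Basis" for b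
    by (rule C_k_on_cong[OF assms(1) assms(3)[OF that]]) (simp add: f')
  ultimately show ?thesis
    by simp
qed

lemma C_k_on_SucD: "C_k_on (Suc k) f U \<Longrightarrow> C_k_on k f U"
  by (induction k arbitrary: f) (auto intro: differentiable_imp_continuous_on)

lemma C_k_on_has_derivative:
  assumes "open U" "C_k_on (Suc k) f U" "x \<in> U"
  shows "(f has_derivative frechet_derivative f (at x)) (at x)"
  using assms by (simp add: differentiable_on_eq_differentiable_at frechet_derivative_works)

lemma C_k_on_add:
  assumes "open U"
  shows "C_k_on k f U \<Longrightarrow> C_k_on k g U \<Longrightarrow> C_k_on k (\<lambda>x. f x + g x) U"
proof (induction k arbitrary: f g)
  case (Suc k)
  show ?case
    by (rule C_k_on_SucI[OF assms has_derivative_add[OF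
        C_k_on_has_derivative[OF assms Suc.prems(1)] C_k_on_has_derivative[OF assms Suc.prems(2)]]],
        assumption, assumption, rule Suc.IH)
       (use Suc.prems in auto)
qed (auto intro: continuous_intros)

lemma C_k_on_mult:
  assumes "open U"
  shows "C_k_on k f U \<Longrightarrow> C_k_on k g U \<Longrightarrow> C_k_on k (\<lambda>x. f x * g x) U"
proof (induction k arbitrary: f g)
  case (Suc k)
  show ?case
    by (rule C_k_on_SucI[OF assms has_derivative_mult[OF
        C_k_on_has_derivative[OF assms Suc.prems(1)] C_k_on_has_derivative[OF assms Suc.prems(2)]]],
        assumption, assumption, intro C_k_on_add[OF assms] Suc.IH)
       (use Suc.prems C_k_on_SucD[OF Suc.prems(1)] C_k_on_SucD[OF Suc.prems(2)] in auto)
qed (auto intro: continuous_intros)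

lemma C_k_on_const [simp]: "C_k_on k (\<lambda>x. c) U"
  by (induction k arbitrary: c) auto

lemma C_k_on_linear:
  assumes "open U" "bounded_linear f"
  shows "C_k_on k f U"
proof (cases k)
  case 0
  then show ?thesis using assms by (simp add: linear_continuous_on)
next
  case (Suc j)
  then show ?thesis
    using C_k_on_SucI[OF assms(1), of f "\<lambda>_. f" j] assms(2)
    by (simp add: bounded_linear_imp_has_derivative)
qed

lemma C_k_on_sum:
  assumes "open U" "finite I" "\<And>i. i \<in> I \<Longrightarrow> C_k_on k (f i) U"
  shows "C_k_on k (\<lambda>x. \<Sum>i\<in>I. f i x) U"
  using assms(2,3) by (induction I rule: finite_induct) (auto intro: C_k_on_add[OF assms(1)])

text \<open>The chain rule writes each partial derivative of the composition as a sum of products of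
  partials of \<open>h\<close> with partials of \<open>F\<close> composed with the same
  \<open>h\<close>. Hence the induction keeps \<open>h\<close> fixed and varies \<open>F\<close>. As
  \<open>C_k_on\<close> is scalar, \<open>h\<close> enters through its components.\<close>

lemma C_k_on_compose:
  fixes h :: "'a::euclidean_space \<Rightarrow> 'b::euclidean_space"
  assumes "open U" "open V" "h ` U \<subseteq> V"
  shows "C_k_on k F V \<Longrightarrow> (\<And>b. b \<in> Basis \<Longrightarrow> C_k_on k (\<lambda>x. h x \<bullet> b) U) \<Longrightarrow> C_k_on k (\<lambda>x. F (h x)) U"
proof (induction k arbitrary: F)
  case 0
  have "continuous_on U h"
  proof (subst continuous_on_componentwise, rule ballI)
    show "continuous_on U (\<lambda>x. h x \<bullet> b)" if "b \<in> Basis" for b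
      using 0(2)[OF that] by simp
  qed
  then show ?case
    using 0(1) assms(3) continuous_on_compose2[of V F U h] by simp
next
  case (Suc k)
  define h' where "h' x v = (\<Sum>b\<in>Basis. frechet_derivative (\<lambda>x. h x \<bullet> b) (at x) v *\<^sub>R b)" for x v
  have h': "(h has_derivative h' x) (at x)" if "x \<in> U" for x
  proof (subst has_derivative_componentwise_within, rule ballI)
    show "((\<lambda>x. h x \<bullet> b) has_derivative (\<lambda>v. h' x v \<bullet> b)) (at x)" if "b \<in> Basis" for b
      using C_k_on_has_derivative[OF assms(1) Suc.prems(2)[OF that] \<open>x \<in> U\<close>] that
      by (simp add: h'_def inner_sum_left_Basis)
  qed
  have F: "(F has_derivative frechet_derivative F (at y)) (at y)" if "y \<in> V" for y
    using C_k_on_has_derivative[OF assms(2) Suc.prems(1) that] .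
  have lin: "frechet_derivative F (at y) v = (\<Sum>b\<in>Basis. (v \<bullet> b) * frechet_derivative F (at y) b)"
    if "y \<in> V" for y v
  proof -
    have "linear (frechet_derivative F (at y))"
      using F[OF that] has_derivative_linear by blast
    then have "frechet_derivative F (at y) (\<Sum>b\<in>Basis. (v \<bullet> b) *\<^sub>R b)
        = (\<Sum>b\<in>Basis. (v \<bullet> b) * frechet_derivative F (at y) b)"
      by (simp add: linear_sum linear_scale)
    then show ?thesis by (simp add: euclidean_representation)
  qed
  have "C_k_on k (\<lambda>x. frechet_derivative F (at (h x)) (h' x b)) U" if b: "b \<in> Basis" for b
  proof (rule C_k_on_cong[OF assms(1)])
    show "C_k_on k (\<lambda>x. \<Sum>c\<in>Basis. frechet_derivative (\<lambda>x. h x \<bullet> c) (at x) b * frechet_derivative F (at (h x)) c) U"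
    proof (rule C_k_on_sum[OF assms(1) finite_Basis], rule C_k_on_mult[OF assms(1)])
      fix c :: 'b assume c: "c \<in> Basis"
      show "C_k_on k (\<lambda>x. frechet_derivative (\<lambda>x. h x \<bullet> c) (at x) b) U"
        using Suc.prems(2)[OF c] b by simp
      show "C_k_on k (\<lambda>x. frechet_derivative F (at (h x)) c) U"
        by (rule Suc.IH[OF _ C_k_on_SucD[OF Suc.prems(2)]]) (use Suc.prems(1) c in simp_all)
    qed
    show "(\<Sum>c\<in>Basis. frechet_derivative (\<lambda>x. h x \<bullet> c) (at x) b * frechet_derivative F (at (h x)) c) =
         frechet_derivative F (at (h x)) (h' x b)" if "x \<in> U" for x
      using lin[of "h x" "h' x b"] that assms(3) by (auto simp: h'_def inner_sum_left_Basis)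
  qed
  moreover have "((\<lambda>x. F (h x)) has_derivative (\<lambda>v. frechet_derivative F (at (h x)) (h' x v))) (at x)" if "x \<in> U" for x
    using has_derivative_compose[OF h'[OF that] F] assms(3) that by auto
  ultimately show ?case
    by (rule C_k_on_SucI[OF assms(1), rotated])
qed

text \<open>The derivative -(x \<bullet> v) / |x|^3 is a polynomial in linear functions and 1/|x|
  itself, so the induction hypothesis covers it.\<close>

lemma C_k_on_inverse_norm: "C_k_on k (\<lambda>x::'a::euclidean_space. inverse (norm x)) (-{0})"
proof (induction k)
  case 0
  show ?case by (auto intro!: continuous_intros)
next
  case (Suc k)
  show ?case
  proof (rule C_k_on_SucI)
    fix x :: 'a assume "x \<in> -{0}"
    then show "((\<lambda>x. inverse (norm x)) has_derivative
      (\<lambda>v. (x \<bullet> v) * (- 1 * (inverse (norm x) * (inverse (norm x) * inverse (norm x)))))) (at x)"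
      by (auto intro!: derivative_eq_intros has_derivative_norm
          simp: sgn_div_norm fun_eq_iff field_simps inner_commute)
  next
    fix b :: 'a
    show "C_k_on k (\<lambda>x. (x \<bullet> b) * (- 1 * (inverse (norm x) * (inverse (norm x) * inverse (norm x))))) (- {0})"
      by (intro C_k_on_mult C_k_on_linear Suc C_k_on_const bounded_linear_inner_left) auto
  qed auto
qed

text \<open>Both functions are treated in one induction because each is, up to sign, the derivative
  of the other.\<close>

lemma C_k_on_sin_cos:
  fixes h :: "'a::euclidean_space \<Rightarrow> real"
  assumes "open U"
  shows "C_k_on k h U \<Longrightarrow> C_k_on k (\<lambda>x. sin (h x)) U \<and> C_k_on k (\<lambda>x. cos (h x)) U"
proof (induction k)
  case 0
  then show ?case by (auto intro!: continuous_intros)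
next
  case (Suc k)
  then have s: "C_k_on k (\<lambda>x. sin (h x)) U" and c: "C_k_on k (\<lambda>x. cos (h x)) U"
    using C_k_on_SucD by blast+
  have h: "(h has_derivative frechet_derivative h (at x)) (at x)" if "x \<in> U" for x
    using C_k_on_has_derivative[OF assms Suc.prems that] .
  have hb: "C_k_on k (\<lambda>x. frechet_derivative h (at x) b) U" if "b \<in> Basis" for b
    using Suc.prems that by simp
  have "C_k_on (Suc k) (\<lambda>x. sin (h x)) U"
    by (rule C_k_on_SucI[OF assms, where f' = "\<lambda>x v. frechet_derivative h (at x) v * cos (h x)"])
       (auto intro!: derivative_eq_intros h C_k_on_mult[OF assms] hb c)
  moreover have "C_k_on (Suc k) (\<lambda>x. cos (h x)) U"
  proof (rule C_k_on_SucI[OF assms])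
    show "((\<lambda>x. cos (h x)) has_derivative (\<lambda>v. frechet_derivative h (at x) v * (- 1 * sin (h x)))) (at x)"
      if "x \<in> U" for x
      by (auto intro!: derivative_eq_intros h that)
  qed (intro C_k_on_mult[OF assms] hb s C_k_on_const)
  ultimately show ?case by blast
qed


section \<open>Tangential derivatives on the sphere\<close>

lemma axis_3_components:
  "(axis 1 1 :: real^3) $ 1 = 1" "(axis 1 1 :: real^3) $ 2 = 0" "(axis 1 1 :: real^3) $ 3 = 0"
  "(axis 2 1 :: real^3) $ 1 = 0" "(axis 2 1 :: real^3) $ 2 = 1" "(axis 2 1 :: real^3) $ 3 = 0"
  "(axis 3 1 :: real^3) $ 1 = 0" "(axis 3 1 :: real^3) $ 2 = 0" "(axis 3 1 :: real^3) $ 3 = 1"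
proof -
  have "(1::3) \<noteq> 2" "(1::3) \<noteq> 3" "(2::3) \<noteq> 3" by simp_all
  then show
    "(axis 1 1 :: real^3) $ 1 = 1" "(axis 1 1 :: real^3) $ 2 = 0" "(axis 1 1 :: real^3) $ 3 = 0"
    "(axis 2 1 :: real^3) $ 1 = 0" "(axis 2 1 :: real^3) $ 2 = 1" "(axis 2 1 :: real^3) $ 3 = 0"
    "(axis 3 1 :: real^3) $ 1 = 0" "(axis 3 1 :: real^3) $ 2 = 0" "(axis 3 1 :: real^3) $ 3 = 1"
    unfolding axis_def by (auto dest: sym)
qed

lemma vec_eq_3: "v = w \<longleftrightarrow> v $ 1 = w $ 1 \<and> v $ 2 = w $ 2 \<and> v $ 3 = w $ 3" for v w :: "'a^3"
  unfolding vec_eq_iff forall_3 ..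

lemma inner_3: "v \<bullet> w = v $ 1 * w $ 1 + v $ 2 * w $ 2 + v $ 3 * w $ 3" for v w :: "real^3"
  by (simp add: inner_vec_def sum_3)

lemma radial_projection_on_sphere: "y \<noteq> 0 \<Longrightarrow> y /\<^sub>R norm y \<in> S2"
  by simp

lemma C_k_on_radial_projection:
  "C_k_on k (\<lambda>y::'a::euclidean_space. (y /\<^sub>R norm y) \<bullet> b) (-{0})"
proof -
  have "C_k_on k (\<lambda>y::'a. inverse (norm y) * (y \<bullet> b)) (-{0})"
    by (rule C_k_on_mult C_k_on_inverse_norm C_k_on_linear bounded_linear_inner_left open_delete open_Compl closed_singleton)+
  then show ?thesis by simp
qed

text \<open>The vector \<open>grad f x\<close> is the Euclidean gradient of exactly this function at
  \<open>x\<close>.\<close>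

definition radial_ext :: "(real^3 \<Rightarrow> real) \<Rightarrow> real^3 \<Rightarrow> real" where
  "radial_ext f y = f (y /\<^sub>R norm y)"

lemma radial_ext_sphere [simp]: "x \<in> S2 \<Longrightarrow> radial_ext f x = f x"
  by (simp add: radial_ext_def)

text \<open>Composing the unknown extension with the radial projection gives a canonical one. All
  smooth functions on the sphere thus extend to the same open set \<open>-{0}\<close>, and sums and
  products need no intersection of neighbourhoods.\<close>

lemma C_k_on_radial_ext:
  assumes "smooth_on S2 f"
  shows "C_k_on k (radial_ext f) (-{0})"
proof -
  obtain U F where U: "open U" "S2 \<subseteq> U" "\<forall>k. C_k_on k F U" "\<forall>x\<in>S2. F x = f x"
    using assms unfolding smooth_on_def by auto
  show ?thesis
  proof (rule C_k_on_cong)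
    show "C_k_on k (\<lambda>y. F (y /\<^sub>R norm y)) (-{0})"
    proof (rule C_k_on_compose[of _ U])
      show "(\<lambda>y. y /\<^sub>R norm y) ` (- {0}) \<subseteq> U"
        using radial_projection_on_sphere U(2) by blast
    qed (use U C_k_on_radial_projection in auto)
    show "F (y /\<^sub>R norm y) = radial_ext f y" if "y \<in> -{0}" for y
      using U(4) radial_projection_on_sphere[of y] that by (auto simp: radial_ext_def)
  qed auto
qed

lemma smooth_onI:
  assumes "open U" "A \<subseteq> U" "\<And>k. C_k_on k F U" "\<And>x. x \<in> A \<Longrightarrow> F x = f x"
  shows "smooth_on A f"
  using assms unfolding smooth_on_def by blast

lemma smooth_on_radial_ext:
  assumes "\<And>k. C_k_on k (radial_ext f) (-{0})" shows "smooth_on S2 f"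
  by (rule smooth_onI[OF _ _ assms]) auto

lemma smooth_on_cong:
  assumes "smooth_on A f" "\<And>x. x \<in> A \<Longrightarrow> f x = g x"
  shows "smooth_on A g"
  using assms unfolding smooth_on_def by metis

lemma smooth_on_add:
  assumes "smooth_on S2 f" "smooth_on S2 g"
  shows "smooth_on S2 (\<lambda>x. f x + g x)"
  using C_k_on_add[OF _ C_k_on_radial_ext[OF assms(1)] C_k_on_radial_ext[OF assms(2)]]
  by (intro smooth_on_radial_ext) (auto simp: radial_ext_def[abs_def])

lemma smooth_on_mult:
  assumes "smooth_on S2 f" "smooth_on S2 g"
  shows "smooth_on S2 (\<lambda>x. f x * g x)"
  using C_k_on_mult[OF _ C_k_on_radial_ext[OF assms(1)] C_k_on_radial_ext[OF assms(2)]]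
  by (intro smooth_on_radial_ext) (auto simp: radial_ext_def[abs_def])

lemma smooth_on_const: "smooth_on A (\<lambda>x. c)"
  by (rule smooth_onI[of UNIV]) auto

lemma smooth_on_linear: "bounded_linear f \<Longrightarrow> smooth_on A f"
  by (rule smooth_onI[of UNIV]) (auto intro: C_k_on_linear)

lemma smooth_on_sum:
  assumes "finite I" "\<And>i. i \<in> I \<Longrightarrow> smooth_on S2 (f i)"
  shows "smooth_on S2 (\<lambda>x. \<Sum>i\<in>I. f i x)"
  using assms by (induction I rule: finite_induct) (auto intro: smooth_on_const smooth_on_add)

lemma smooth_on_imp_continuous_on: "smooth_on A f \<Longrightarrow> continuous_on A f"
  unfolding smooth_on_def by (metis C_k_on.simps(1) continuous_on_cong continuous_on_subset)

lemma grad_eqI: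
  assumes "(radial_ext f has_derivative (\<lambda>v. P \<bullet> v)) (at x)"
  shows "grad f x = P"
proof -
  have "frechet_derivative (radial_ext f) (at x) = (\<lambda>v. P \<bullet> v)"
    using frechet_derivative_at[OF assms] by simp
  then show ?thesis
    by (simp add: grad_def radial_ext_def[abs_def] vec_eq_iff inner_axis)
qed

lemma linear_functional_eq_inner:
  fixes L :: "real^'n \<Rightarrow> real"
  assumes "linear L"
  shows "L v = (\<chi> i. L (axis i 1)) \<bullet> v"
proof -
  have "L v = L (\<Sum>i\<in>UNIV. v $ i *\<^sub>R axis i 1)"
    using basis_expansion[of v] by (simp add: scalar_mult_eq_scaleR)
  also have "\<dots> = (\<chi> i. L (axis i 1)) \<bullet> v"
    using assms by (simp add: linear_sum linear_scale inner_vec_def mult.commute)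
  finally show ?thesis .
qed

lemma has_derivative_radial_ext:
  assumes "smooth_on S2 f" "x \<noteq> 0"
  shows "(radial_ext f has_derivative (\<lambda>v. grad f x \<bullet> v)) (at x)"
proof -
  have d: "(radial_ext f has_derivative frechet_derivative (radial_ext f) (at x)) (at x)"
    using C_k_on_has_derivative[OF _ C_k_on_radial_ext[OF assms(1)]] assms(2) by auto
  have "grad f x = (\<chi> i. frechet_derivative (radial_ext f) (at x) (axis i 1))"
    by (simp add: grad_def radial_ext_def[abs_def])
  then have "frechet_derivative (radial_ext f) (at x) v = grad f x \<bullet> v" for v
    using linear_functional_eq_inner[OF has_derivative_linear[OF d], of v] by simp
  then show ?thesis using d by presburger
qed

lemma has_derivative_radial_projection:
  fixes x :: "'a::euclidean_space"
  assumes "norm x = 1"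
  shows "((\<lambda>y. y /\<^sub>R norm y) has_derivative (\<lambda>v. v - (x \<bullet> v) *\<^sub>R x)) (at x)"
proof -
  have "x \<noteq> 0" using assms by auto
  then show ?thesis
    by (auto intro!: derivative_eq_intros has_derivative_norm simp: sgn_div_norm assms inner_commute)
qed

lemma has_derivative_radial_ext_extension:
  assumes "x \<in> S2" "(F has_derivative F') (at x)" "\<And>y. y \<in> S2 \<Longrightarrow> F y = f y"
  shows "(radial_ext f has_derivative (\<lambda>v. F' (v - (x \<bullet> v) *\<^sub>R x))) (at x)"
proof (rule has_derivative_transform_within_open)
  have x: "norm x = 1" using assms(1) by simp
  show "((\<lambda>y. F (y /\<^sub>R norm y)) has_derivative (\<lambda>v. F' (v - (x \<bullet> v) *\<^sub>R x))) (at x)"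
    by (rule has_derivative_compose[OF has_derivative_radial_projection[OF x]])
       (use assms(2) x in simp)
  show "F (y /\<^sub>R norm y) = radial_ext f y" if "y \<in> -{0}" for y
    using assms(3) radial_projection_on_sphere[of y] that by (auto simp: radial_ext_def)
qed (use assms(1) in auto)

text \<open>The radial projection has as derivative at \<open>x\<close> the orthogonal projection to
  the tangent plane. So gradients can be computed from any convenient extension, for instance a
  polynomial, by discarding the normal part of \<open>v\<close>.\<close>

lemma grad_extension:
  assumes "x \<in> S2" "(F has_derivative F') (at x)" "\<And>y. y \<in> S2 \<Longrightarrow> F y = f y"
  shows "grad f x \<bullet> v = F' (v - (x \<bullet> v) *\<^sub>R x)"
proof -
  define L where "L v = F' (v - (x \<bullet> v) *\<^sub>R x)" for v
  have d: "(radial_ext f has_derivative L) (at x)"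
    unfolding L_def by (rule has_derivative_radial_ext_extension) fact+
  obtain P where P: "\<And>v. L v = P \<bullet> v"
    using linear_functional_eq_inner[OF has_derivative_linear[OF d]] by blast
  then have "L = (\<lambda>v. P \<bullet> v)" by blast
  then have "grad f x = P"
    using d grad_eqI by blast
  then have "grad f x \<bullet> v = L v"
    by (simp only: P)
  then show ?thesis by (simp only: L_def)
qed

lemma grad_tangential:
  assumes "smooth_on S2 f" "x \<in> S2"
  shows "grad f x \<bullet> x = 0"
proof -
  have "linear (\<lambda>v. grad f x \<bullet> v)"
    by (simp add: bounded_linear.linear bounded_linear_inner_right)
  moreover have "x \<noteq> 0" using assms(2) by auto
  ultimately show ?thesis
    using grad_extension[OF assms(2) has_derivative_radial_ext[OF assms(1)], of f x] assms(2)
    by (simp add: power2_norm_eq_inner[symmetric])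
qed

lemma smooth_on_grad:
  assumes "smooth_on S2 f"
  shows "smooth_on S2 (\<lambda>x. grad f x $ i)"
proof (rule smooth_onI[of "-{0}"])
  show "C_k_on k (\<lambda>x. grad f x $ i) (-{0})" for k
    using C_k_on_radial_ext[OF assms, of "Suc k"]
    by (simp add: grad_def radial_ext_def[abs_def])
qed auto

lemma has_derivative_grad:
  assumes "smooth_on S2 f" "x \<noteq> 0"
  obtains G' where "(grad f has_derivative G') (at x)"
proof -
  define F where "F = frechet_derivative (radial_ext f)"
  have "C_k_on (Suc 0) (\<lambda>x. F (at x) b) (-{0})" if "b \<in> Basis" for b
    using C_k_on_radial_ext[OF assms(1), of "Suc (Suc 0)"] that unfolding F_def by (subst (asm) C_k_on.simps(2)) blast
  from C_k_on_has_derivative[OF _ this, of b for b]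
  have "((\<lambda>x. F (at x) b) has_derivative frechet_derivative (\<lambda>x. F (at x) b) (at x)) (at x)"
      if "b \<in> Basis" for b
    using that assms(2) by auto
  moreover have "axis i 1 \<in> (Basis :: (real^3) set)" for i
    by (auto simp: Basis_vec_def)
  ultimately have i: "((\<lambda>x. F (at x) (axis i 1)) has_derivative frechet_derivative (\<lambda>x. F (at x) (axis i 1)) (at x)) (at x)" for i
    by blast
  have g: "grad f x $ i = F (at x) (axis i 1)" for x i
    by (simp add: grad_def radial_ext_def[abs_def] F_def)
  have "(grad f has_derivative (\<lambda>v. \<chi> i. frechet_derivative (\<lambda>x. F (at x) (axis i 1)) (at x) v)) (at x)"
    by (subst has_derivative_componentwise_within) (auto simp: Basis_vec_def inner_axis g i)
  then show ?thesis using that by blast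
qed

text \<open>The trace over the tangent plane is the full trace minus the normal entry;
  \<open>W\<close> may be any extension of the field.\<close>

lemma divergence_extension:
  assumes "x \<in> S2" "(W has_derivative W') (at x)" "\<And>y. y \<in> S2 \<Longrightarrow> W y = V y"
  shows "divergence V x = (\<Sum>i\<in>UNIV. W' (axis i 1) $ i) - W' x \<bullet> x"
proof -
  have "linear W'" using assms(2) has_derivative_linear by blast
  have "grad (\<lambda>y. V y $ i) x $ i = W' (axis i 1) $ i - W' x $ i * x $ i" for i
  proof -
    have "grad (\<lambda>y. V y $ i) x \<bullet> axis i 1 = W' (axis i 1 - (x \<bullet> axis i 1) *\<^sub>R x) $ i"
      using grad_extension[OF assms(1), of "\<lambda>y. W y $ i" "\<lambda>v. W' v $ i"] assms(2,3)
      by (simp add: bounded_linear.has_derivative[OF bounded_linear_vec_nth])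
    then show ?thesis
      using \<open>linear W'\<close> by (simp add: linear_diff linear_scale inner_axis)
  qed
  then show ?thesis
    by (simp add: divergence_def sum_subtractf inner_vec_def)
qed

text \<open>The generator of the rotations about \<open>a\<close>: the derivative along the Killing
  field a x x. This field is tangent and smooth on the whole sphere, unlike a coordinate
  frame.\<close>

definition rot_deriv :: "real^3 \<Rightarrow> (real^3 \<Rightarrow> real) \<Rightarrow> real^3 \<Rightarrow> real" where
  "rot_deriv a f x = cross3 a x \<bullet> grad f x"

lemma rot_deriv_extension:
  assumes "x \<in> S2" "(F has_derivative F') (at x)" "\<And>y. y \<in> S2 \<Longrightarrow> F y = f y"
  shows "rot_deriv a f x = F' (cross3 a x)"
  using grad_extension[OF assms, where v = "cross3 a x"] by (simp add: rot_deriv_def inner_commute dot_cross_self)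

lemma bounded_linear_cross3: "bounded_linear (\<lambda>x. cross3 a x)"
  using bilinear_cross by (simp add: bilinear_def linear_conv_bounded_linear)

lemma smooth_on_rot_deriv:
  assumes "smooth_on S2 f"
  shows "smooth_on S2 (rot_deriv a f)"
  unfolding rot_deriv_def[abs_def] inner_vec_def inner_real_def
  by (intro smooth_on_sum smooth_on_mult smooth_on_grad assms smooth_on_linear
      bounded_linear_compose[OF bounded_linear_vec_nth] bounded_linear_cross3 finite)

lemma rot_deriv_mult:
  assumes "smooth_on S2 f" "smooth_on S2 g" "x \<in> S2"
  shows "rot_deriv a (\<lambda>x. f x * g x) x = f x * rot_deriv a g x + rot_deriv a f x * g x"
proof -
  have "x \<noteq> 0" using assms(3) by auto
  show ?thesis
    using rot_deriv_extension[OF assms(3) has_derivative_mult[OF has_derivative_radial_ext[OF assms(1) \<open>x \<noteq> 0\<close>]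
       has_derivative_radial_ext[OF assms(2) \<open>x \<noteq> 0\<close>]], of "\<lambda>x. f x * g x" a] assms(3)
    by (simp add: rot_deriv_def inner_commute)
qed

lemma laplace_beltrami_eq:
  assumes "x \<in> S2" "(grad f has_derivative G') (at x)"
  shows "laplace_beltrami f x = (\<Sum>i\<in>UNIV. G' (axis i 1) $ i) - G' x \<bullet> x"
  unfolding laplace_beltrami_def by (rule divergence_extension[OF assms]) simp

text \<open>With e_i the standard basis, the matrices (e_i x x)(e_i x x)^T sum to |x|^2 I - x x^T,
  the tangential projection, so the second-order parts agree. The vectors e_i x (e_i x x) sum to -2
  x, so the first-order part pairs the gradient with the normal and vanishes.\<close>

lemma laplace_beltrami_rot_deriv:
  assumes f: "smooth_on S2 f" and x: "x \<in> S2"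
  shows "laplace_beltrami f x = (\<Sum>i\<in>UNIV. rot_deriv (axis i 1) (rot_deriv (axis i 1) f) x)"
proof -
  have "x \<noteq> 0" using x by auto
  then obtain G' where G: "(grad f has_derivative G') (at x)"
    using has_derivative_grad[OF f] by blast
  then have lin: "linear G'" using has_derivative_linear by blast
  have D: "rot_deriv a (rot_deriv a f) x = cross3 a x \<bullet> G' (cross3 a x) + cross3 a (cross3 a x) \<bullet> grad f x" for a
  proof -
    have "(rot_deriv a f has_derivative (\<lambda>v. cross3 a x \<bullet> G' v + cross3 a v \<bullet> grad f x)) (at x)"
      unfolding rot_deriv_def
      by (intro has_derivative_inner G bounded_linear_imp_has_derivative bounded_linear_cross3)
    from rot_deriv_extension[OF x this] show ?thesis by simp
  qed
  have xx: "x$1 * x$1 + x$2 * x$2 + x$3 * x$3 = 1"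
    using x by (simp add: norm_eq_sqrt_inner inner_vec_def sum_3)
  have G': "G' v = v$1 *\<^sub>R G' (axis 1 1) + v$2 *\<^sub>R G' (axis 2 1) + v$3 *\<^sub>R G' (axis 3 1)" for v
  proof -
    have "v = v$1 *\<^sub>R axis 1 1 + v$2 *\<^sub>R axis 2 1 + v$3 *\<^sub>R axis 3 1"
      by (simp add: vec_eq_3 axis_3_components)
    then have "G' v = G' (v$1 *\<^sub>R axis 1 1 + v$2 *\<^sub>R axis 2 1 + v$3 *\<^sub>R axis 3 1)" by (rule arg_cong)
    then show ?thesis using lin by (simp add: linear_add linear_scale)
  qed
  have "(\<Sum>i\<in>UNIV. cross3 (axis i 1) (cross3 (axis i 1) x) \<bullet> grad f x) = - 2 * (grad f x \<bullet> x)"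
    by (simp add: sum_3 cross_components inner_3 axis_3_components algebra_simps)
  then have 1: "(\<Sum>i\<in>UNIV. cross3 (axis i 1) (cross3 (axis i 1) x) \<bullet> grad f x) = 0"
    using grad_tangential[OF f x] by simp
  have "(\<Sum>i\<in>UNIV. cross3 (axis i 1) x \<bullet> G' (cross3 (axis i 1) x))
      = (x$1 * x$1 + x$2 * x$2 + x$3 * x$3) * (\<Sum>i\<in>UNIV. G' (axis i 1) $ i) - G' x \<bullet> x"
    unfolding G'[of x] sum_3 G'[of "cross3 _ _"]
    by (simp add: cross_components inner_3 sum_3 axis_3_components algebra_simps)
  then show ?thesis
    using laplace_beltrami_eq[OF x G] 1 by (simp add: D sum.distrib xx)
qed


section \<open>Integration over the sphere\<close>

definition sph_box :: "(real \<times> real) set" where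
  "sph_box = cbox (-pi, -pi/2) (pi, pi/2)"

text \<open>The unit eastward vector. The longitude derivative of \<open>sph_coords\<close> is cos
  \<theta> times it; leaving out the cosine keeps it a unit vector at the poles.\<close>

definition e_lon :: "real \<Rightarrow> real^3" where
  "e_lon \<phi> = vector [- sin \<phi>, cos \<phi>, 0]"

definition e_lat :: "real \<Rightarrow> real \<Rightarrow> real^3" where
  "e_lat \<phi> \<theta> = vector [- sin \<theta> * cos \<phi>, - sin \<theta> * sin \<phi>, cos \<theta>]"

lemma sph_coords_components:
  "sph_coords (\<phi>, \<theta>) $ 1 = cos \<theta> * cos \<phi>"
  "sph_coords (\<phi>, \<theta>) $ 2 = cos \<theta> * sin \<phi>"
  "sph_coords (\<phi>, \<theta>) $ 3 = sin \<theta>"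
  by (simp_all add: sph_coords_def)

lemma sph_coords_in_S2: "sph_coords z \<in> S2"
proof -
  obtain \<phi> \<theta> where z: "z = (\<phi>, \<theta>)" by fastforce
  have "(norm (sph_coords z))\<^sup>2 = (cos \<theta>)\<^sup>2 * ((cos \<phi>)\<^sup>2 + (sin \<phi>)\<^sup>2) + (sin \<theta>)\<^sup>2"
    unfolding power2_norm_eq_inner inner_3 sph_coords_components z by algebra
  also have "\<dots> = 1" by simp
  finally show ?thesis by (simp add: norm_eq_1 power2_norm_eq_inner)
qed

lemma sph_coords_surj:
  assumes "x \<in> S2"
  obtains \<phi> \<theta> where "(\<phi>, \<theta>) \<in> sph_box" "x = sph_coords (\<phi>, \<theta>)"
proof -
  have x: "(x$1)\<^sup>2 + (x$2)\<^sup>2 + (x$3)\<^sup>2 = 1"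
    using assms by (simp add: norm_eq_1 inner_3 power2_eq_square)
  then have "(x$3)\<^sup>2 \<le> 1"
    using zero_le_power2[of "x$1"] zero_le_power2[of "x$2"] by linarith
  then have x3: "-1 \<le> x$3" "x$3 \<le> 1" by (simp_all add: abs_square_le_1 abs_le_iff)
  define \<theta> where "\<theta> = arcsin (x$3)"
  have \<theta>: "- pi / 2 \<le> \<theta>" "\<theta> \<le> pi / 2" "sin \<theta> = x$3"
    unfolding \<theta>_def using arcsin[OF x3] by auto
  then have c: "cos \<theta> \<ge> 0" by (intro cos_ge_zero) auto
  show ?thesis
  proof (cases "cos \<theta> = 0")
    case True
    then have "(x$3)\<^sup>2 = 1" using \<theta>(3) sin_cos_squared_add[of \<theta>] by simp
    then have "(x$1)\<^sup>2 = 0" "(x$2)\<^sup>2 = 0" using x zero_le_power2[of "x$1"] zero_le_power2[of "x$2"] by linarith+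
    then have "x = sph_coords (0, \<theta>)" by (simp add: vec_eq_3 sph_coords_components True \<theta>(3))
    then show ?thesis using that[of 0 \<theta>] \<theta> by (simp add: sph_box_def)
  next
    case False
    have "(x$1)\<^sup>2 + (x$2)\<^sup>2 = (cos \<theta>)\<^sup>2"
      using x \<theta>(3) sin_cos_squared_add[of \<theta>] by simp
    then have "(x$1 / cos \<theta>)\<^sup>2 + (x$2 / cos \<theta>)\<^sup>2 = 1"
      using False by (simp add: power_divide add_divide_distrib[symmetric])
    then obtain \<phi> where \<phi>: "-pi \<le> \<phi>" "\<phi> \<le> pi" "x$1 / cos \<theta> = cos \<phi>" "x$2 / cos \<theta> = sin \<phi>"
      by (metis sincos_principal_value sincos_total_2pi less_imp_le)
    then have "x = sph_coords (\<phi>, \<theta>)"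
      using False by (simp add: vec_eq_3 sph_coords_components \<theta>(3) field_simps)
    then show ?thesis using that[of \<phi> \<theta>] \<theta> \<phi> by (simp add: sph_box_def)
  qed
qed

lemma continuous_on_sph_coords: "continuous_on A sph_coords"
proof -
  have "continuous_on A (\<lambda>z. \<chi> i. sph_coords z $ i)"
  proof (rule continuous_on_vec_lambda)
    have "continuous_on A (\<lambda>z. sph_coords z $ 1)" "continuous_on A (\<lambda>z. sph_coords z $ 2)" "continuous_on A (\<lambda>z. sph_coords z $ 3)"
      by (auto simp: sph_coords_def case_prod_unfold intro!: continuous_intros)
    then show "continuous_on A (\<lambda>z. sph_coords z $ i)" for i
      using exhaust_3[of i] by auto
  qed
  then show ?thesis by simp
qed

lemma measurable_sph_coords: "sph_coords \<in> restrict_space lborel sph_box \<rightarrow>\<^sub>M restrict_space borel S2"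
proof -
  have "sph_coords \<in> borel_measurable lborel"
    using borel_measurable_continuous_onI[OF continuous_on_sph_coords] by simp
  then show ?thesis
    using sph_coords_in_S2 by (intro measurable_restrict_space2 measurable_restrict_space1) auto
qed

lemma area_measure_eq:
  "area_measure = distr (density (restrict_space lborel sph_box) (\<lambda>z. ennreal (cos (snd z))))
     (restrict_space borel S2) sph_coords"
  by (simp add: area_measure_def sph_box_def cbox_Pair_eq case_prod_unfold)

lemma space_area_measure: "space area_measure = S2"
  by (simp add: area_measure_eq space_restrict_space)

lemma measurable_area_measure:
  "continuous_on S2 f \<Longrightarrow> f \<in> borel_measurable area_measure"
  unfolding area_measure_eq measurable_distr_eq1
  by (rule borel_measurable_continuous_on_restrict)

lemma continuous_on_sph_integrand:
  fixes f :: "real^3 \<Rightarrow> real"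
  assumes "continuous_on S2 f"
  shows "continuous_on sph_box (\<lambda>z. cos (snd z) * f (sph_coords z))"
  using sph_coords_in_S2
  by (intro continuous_intros continuous_on_compose2[OF assms continuous_on_sph_coords]) auto

lemma cos_snd_nonneg: "z \<in> sph_box \<Longrightarrow> cos (snd z) \<ge> 0"
  by (cases z) (auto simp: sph_box_def cbox_Pair_eq intro!: cos_ge_zero)

text \<open>This passes from the push-forward measure to a gauge integral of a continuous function
  over a box, where the fundamental theorem of calculus and the exchange of integrations are
  applied.\<close>

lemma area_integral:
  fixes f :: "real^3 \<Rightarrow> real"
  assumes "continuous_on S2 f"
  shows "integrable area_measure f"
    and "(\<integral>x. f x \<partial>area_measure) = integral sph_box (\<lambda>z. cos (snd z) * f (sph_coords z))"
proof -
  let ?R = "restrict_space lborel sph_box" and ?g = "\<lambda>z. cos (snd z) * f (sph_coords z)"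
  have f: "f \<in> borel_measurable (restrict_space borel S2)"
    by (rule borel_measurable_continuous_on_restrict[OF assms])
  have fs: "(\<lambda>z. f (sph_coords z)) \<in> borel_measurable ?R"
    using measurable_compose[OF measurable_sph_coords f] .
  have c: "(\<lambda>z. cos (snd z)) \<in> borel_measurable ?R"
  proof (rule measurable_restrict_space1)
    have "continuous_on UNIV (\<lambda>z::real \<times> real. cos (snd z))" by (intro continuous_intros)
    then show "(\<lambda>z::real \<times> real. cos (snd z)) \<in> borel_measurable lborel"
      using borel_measurable_continuous_onI[of "\<lambda>z::real \<times> real. cos (snd z)"] by simp
  qed
  have pos: "AE z in ?R. 0 \<le> cos (snd z)"
    using cos_snd_nonneg by (intro AE_I2) (auto simp: space_restrict_space)
  have sb: "sph_box \<inter> space lborel \<in> sets lborel" by (simp add: sph_box_def)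
  have sph: "sph_coords \<in> density ?R (\<lambda>z. ennreal (cos (snd z))) \<rightarrow>\<^sub>M restrict_space borel S2"
    using measurable_sph_coords by simp
  have int: "set_integrable lborel sph_box ?g"
    unfolding set_integrable_def
    using borel_integrable_compact[of sph_box ?g] continuous_on_sph_integrand[OF assms]
    by (simp add: sph_box_def)
  show "integrable area_measure f"
    unfolding area_measure_eq integrable_distr_eq[OF sph f] integrable_density[OF fs c pos]
    using int by (simp add: integrable_restrict_space[OF sb] set_integrable_def)
  have "(\<integral>x. f x \<partial>area_measure) = (\<integral>z. cos (snd z) * f (sph_coords z) \<partial>?R)"
    unfolding area_measure_eq integral_distr[OF sph f] integral_density[OF fs c pos] by simp
  also have "\<dots> = (LINT z:sph_box|lborel. ?g z)"
    by (simp add: integral_restrict_space[OF sb] set_lebesgue_integral_def)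
  also have "\<dots> = integral sph_box ?g"
    by (rule set_borel_integral_eq_integral(2)[OF int])
  finally show "(\<integral>x. f x \<partial>area_measure) = integral sph_box ?g" .
qed

lemma finite_measure_area: "finite_measure area_measure"
proof -
  have "integrable area_measure (\<lambda>x. 1::real)"
    by (rule area_integral) auto
  then show ?thesis
    by (auto simp: integrable_iff_bounded ennreal_top_eq_mult_iff intro!: finite_measureI)
qed

text \<open>The density cos \<theta> vanishes at the poles, so the vanishing integral gives the
  claim only away from them. The poles are reached by continuity along a meridian.\<close>

lemma area_integral_nonneg_eq_0:
  fixes f :: "real^3 \<Rightarrow> real"
  assumes f: "continuous_on S2 f" "\<And>x. x \<in> S2 \<Longrightarrow> f x \<ge> 0" "(\<integral>x. f x \<partial>area_measure) = 0"
    and x: "x \<in> S2"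
  shows "f x = 0"
proof -
  let ?g = "\<lambda>z. cos (snd z) * f (sph_coords z)"
  have "integral (cbox (-pi, -pi/2) (pi, pi/2)) ?g = 0"
    using area_integral(2)[OF f(1)] f(3) by (simp add: sph_box_def)
  note int0 = this
  have 0: "?g z = 0" if "z \<in> sph_box" for z
  proof -
    have "(0, 0) \<in> box (-pi, -pi/2) (pi, pi/2)" by (auto simp: mem_box Basis_prod_def)
    then have "box (-pi, -pi/2) (pi, pi/2) \<noteq> {}" by blast
    then have "\<forall>z\<in>cbox (-pi, -pi/2) (pi, pi/2). ?g z = 0"
      using integral_cbox_eq_0_iff[of "(-pi, -pi/2)" "(pi, pi/2)" ?g] continuous_on_sph_integrand[OF f(1)]
        int0 cos_snd_nonneg f(2)[OF sph_coords_in_S2] by (simp add: sph_box_def)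
    then show ?thesis using that by (simp add: sph_box_def)
  qed
  obtain \<phi> \<theta> where z: "(\<phi>, \<theta>) \<in> sph_box" "x = sph_coords (\<phi>, \<theta>)"
    using sph_coords_surj[OF x] .
  define h where "h t = f (sph_coords (\<phi>, t))" for t
  have h: "continuous_on {-pi/2..pi/2} h"
    unfolding h_def using sph_coords_in_S2
    by (intro continuous_on_compose2[OF f(1)] continuous_on_compose2[OF continuous_on_sph_coords] continuous_intros) auto
  have "h t = 0" if "t \<in> {-pi/2<..<pi/2}" for t
    using 0[of "(\<phi>, t)"] cos_gt_zero_pi[of t] that z(1) by (auto simp: h_def sph_box_def cbox_Pair_eq)
  then have "h t = 0" if "t \<in> closure {-pi/2<..<pi/2}" for t
    using continuous_constant_on_closure[of "{-pi/2<..<pi/2}" h 0] h that by (simp add: closure_greaterThanLessThan)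
  then show ?thesis
    using z by (simp add: h_def sph_box_def cbox_Pair_eq closure_greaterThanLessThan)
qed

text \<open>The vectors \<open>e_lon\<close>, \<open>e_lat\<close> and the point itself form a
  positively oriented orthonormal frame.\<close>

lemma cross3_sph_coords:
  "cross3 a (sph_coords (\<phi>, \<theta>)) = (a \<bullet> e_lat \<phi> \<theta>) *\<^sub>R e_lon \<phi> - (a \<bullet> e_lon \<phi>) *\<^sub>R e_lat \<phi> \<theta>"
proof -
  have s: "sin \<phi> * sin \<phi> = 1 - cos \<phi> * cos \<phi>" for \<phi> :: real
    using sin_cos_squared_add[of \<phi>] by (simp add: power2_eq_square)
  have s': "sin \<phi> * (sin \<phi> * z) = (1 - cos \<phi> * cos \<phi>) * z" for \<phi> z :: real
    by (simp add: s mult.assoc[symmetric])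
  show ?thesis
    by (simp add: vec_eq_3 cross_components sph_coords_components e_lat_def e_lon_def inner_3 algebra_simps s s')
qed

lemma has_vector_derivative_vec_3:
  fixes f :: "real \<Rightarrow> real^3"
  assumes "((\<lambda>t. f t $ 1) has_real_derivative d $ 1) (at x within S)" "((\<lambda>t. f t $ 2) has_real_derivative d $ 2) (at x within S)"
    "((\<lambda>t. f t $ 3) has_real_derivative d $ 3) (at x within S)"
  shows "(f has_vector_derivative d) (at x within S)"
proof -
  have "((\<lambda>t. f t $ i) has_real_derivative d $ i) (at x within S)" for i
    using exhaust_3[of i] assms by auto
  then have "((\<lambda>t. f t $ i) has_derivative (\<lambda>v. v * d $ i)) (at x within S)" for i
    unfolding has_field_derivative_def by (rule has_derivative_eq_rhs) (simp add: fun_eq_iff)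
  then show ?thesis
    unfolding has_vector_derivative_def
    by (subst has_derivative_componentwise_within) (auto simp: Basis_vec_def inner_axis)
qed

text \<open>In spherical coordinates the integrand is the divergence of a field that is periodic in \<open>\<phi>\<close> and
  vanishes at \<open>\<theta> = \<plusminus>\<pi>/2\<close>, because the area element cancels the coordinate singularity at the poles.\<close>

lemma integral_rot_deriv:
  assumes f: "smooth_on S2 f"
  shows "(\<integral>x. rot_deriv a f x \<partial>area_measure) = 0"
proof -
  let ?s = "\<lambda>\<phi> \<theta>. sph_coords (\<phi>, \<theta>)"
  \<comment> \<open>\<open>A\<close> and \<open>B\<close> are the \<phi>-derivative of (a \<bullet>
    e_lat) f and the \<theta>-derivative of cos \<theta> (a \<bullet> e_lon) f. Their zeroth-order
    terms coincide, so the difference contains only derivatives of \<open>f\<close>.\<close>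
  define A where "A \<phi> \<theta> = - sin \<theta> * (a \<bullet> e_lon \<phi>) * f (?s \<phi> \<theta>) + (a \<bullet> e_lat \<phi> \<theta>) * cos \<theta> * (grad f (?s \<phi> \<theta>) \<bullet> e_lon \<phi>)" for \<phi> \<theta>
  define B where "B \<phi> \<theta> = - sin \<theta> * (a \<bullet> e_lon \<phi>) * f (?s \<phi> \<theta>) + (a \<bullet> e_lon \<phi>) * cos \<theta> * (grad f (?s \<phi> \<theta>) \<bullet> e_lat \<phi> \<theta>)" for \<phi> \<theta>
  have AB: "cos \<theta> * rot_deriv a f (?s \<phi> \<theta>) = A \<phi> \<theta> - B \<phi> \<theta>" for \<phi> \<theta>
    by (simp add: A_def B_def rot_deriv_def cross3_sph_coords inner_diff_right inner_commute algebra_simps)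
  have s0: "?s \<phi> \<theta> \<noteq> 0" for \<phi> \<theta> using sph_coords_in_S2[of "(\<phi>, \<theta>)"] by auto
  have ext: "radial_ext f (?s \<phi> \<theta>) = f (?s \<phi> \<theta>)" for \<phi> \<theta> using sph_coords_in_S2 by simp
  have lon: "((\<lambda>\<phi>. ?s \<phi> \<theta>) has_vector_derivative cos \<theta> *\<^sub>R e_lon \<phi>) (at \<phi> within S)" for \<phi> \<theta> S
    by (rule has_vector_derivative_vec_3)
      (auto simp: sph_coords_components e_lon_def intro!: derivative_eq_intros)
  have lat: "((\<lambda>\<theta>. ?s \<phi> \<theta>) has_vector_derivative e_lat \<phi> \<theta>) (at \<theta> within S)" for \<phi> \<theta> S
    by (rule has_vector_derivative_vec_3)
      (auto simp: sph_coords_components e_lat_def intro!: derivative_eq_intros)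
  have flon: "((\<lambda>\<phi>. f (?s \<phi> \<theta>)) has_vector_derivative cos \<theta> * (grad f (?s \<phi> \<theta>) \<bullet> e_lon \<phi>)) (at \<phi> within S)" for \<phi> \<theta> S
    using vector_derivative_diff_chain_within[OF lon has_derivative_at_withinI[OF has_derivative_radial_ext[OF f s0]]]
    by (simp add: o_def ext)
  have flat: "((\<lambda>\<theta>. f (?s \<phi> \<theta>)) has_vector_derivative grad f (?s \<phi> \<theta>) \<bullet> e_lat \<phi> \<theta>) (at \<theta> within S)" for \<phi> \<theta> S
    using vector_derivative_diff_chain_within[OF lat has_derivative_at_withinI[OF has_derivative_radial_ext[OF f s0]]]
    by (simp add: o_def ext)
  have contS: "continuous_on T (\<lambda>z. f (sph_coords z))" for T
    using sph_coords_in_S2 smooth_on_imp_continuous_on[OF f]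
    by (intro continuous_on_compose2[OF _ continuous_on_sph_coords]) auto
  define G where "G i z = grad f (sph_coords z) $ i" for i z
  have contG: "continuous_on T (\<lambda>z. G i z)" for T i
    unfolding G_def
    using sph_coords_in_S2 smooth_on_imp_continuous_on[OF smooth_on_grad[OF f]]
    by (intro continuous_on_compose2[OF _ continuous_on_sph_coords]) auto
  have contA: "continuous_on T (\<lambda>z. A (fst z) (snd z))" and contB: "continuous_on T (\<lambda>z. B (fst z) (snd z))" for T
    unfolding A_def B_def inner_3 e_lon_def e_lat_def vector_3 prod.collapse G_def[symmetric]
    by (intro continuous_intros contS contG)+
  have dA: "((\<lambda>\<phi>. (a \<bullet> e_lat \<phi> \<theta>) * f (?s \<phi> \<theta>)) has_vector_derivative A \<phi> \<theta>) (at \<phi> within S)" for \<phi> \<theta> S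
  proof -
    have "((\<lambda>\<phi>. a \<bullet> e_lat \<phi> \<theta>) has_vector_derivative - sin \<theta> * (a \<bullet> e_lon \<phi>)) (at \<phi> within S)"
      unfolding inner_3 e_lat_def e_lon_def vector_3 has_real_derivative_iff_has_vector_derivative[symmetric]
      by (auto intro!: derivative_eq_intros simp: algebra_simps)
    from has_vector_derivative_mult[OF this flon] show ?thesis
      by (simp add: A_def algebra_simps)
  qed
  have dB: "((\<lambda>\<theta>. cos \<theta> * (a \<bullet> e_lon \<phi>) * f (?s \<phi> \<theta>)) has_vector_derivative B \<phi> \<theta>) (at \<theta> within S)" for \<phi> \<theta> S
  proof -
    have "((\<lambda>\<theta>. cos \<theta> * (a \<bullet> e_lon \<phi>)) has_vector_derivative - sin \<theta> * (a \<bullet> e_lon \<phi>)) (at \<theta> within S)"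
      unfolding has_real_derivative_iff_has_vector_derivative[symmetric]
      by (auto intro!: derivative_eq_intros simp: algebra_simps)
    from has_vector_derivative_mult[OF this flat] show ?thesis
      by (simp add: B_def algebra_simps)
  qed
  have per: "?s (-pi) \<theta> = ?s pi \<theta>" "e_lat (-pi) \<theta> = e_lat pi \<theta>" for \<theta>
    by (simp_all add: sph_coords_def e_lat_def)
  have intA: "integral {-pi..pi} (\<lambda>\<phi>. A \<phi> \<theta>) = 0" for \<theta>
    using integral_unique[OF fundamental_theorem_of_calculus[OF _ dA]] by (simp add: per)
  have intB: "integral {-pi/2..pi/2} (\<lambda>\<theta>. B \<phi> \<theta>) = 0" for \<phi>
    using integral_unique[OF fundamental_theorem_of_calculus[OF _ dB]] by (simp)
  have "integral sph_box (\<lambda>z. B (fst z) (snd z)) = integral {-pi..pi} (\<lambda>\<phi>. integral {-pi/2..pi/2} (\<lambda>\<theta>. B \<phi> \<theta>))"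
    unfolding sph_box_def using integral_prod_continuous[OF contB] by (simp add: cbox_interval)
  then have B0: "integral sph_box (\<lambda>z. B (fst z) (snd z)) = 0" by (simp only: intB Henstock_Kurzweil_Integration.integral_0)
  have "integral sph_box (\<lambda>z. A (fst z) (snd z)) = integral {-pi..pi} (\<lambda>\<phi>. integral {-pi/2..pi/2} (\<lambda>\<theta>. A \<phi> \<theta>))"
    unfolding sph_box_def using integral_prod_continuous[OF contA] by (simp add: cbox_interval)
  \<comment> \<open>The exchange makes \<phi> the inner variable, in which \<open>A\<close>
    integrates to zero by periodicity; for \<open>B\<close> the inner variable was already
    \<theta>.\<close>
  also have "\<dots> = integral {-pi/2..pi/2} (\<lambda>\<theta>. integral {-pi..pi} (\<lambda>\<phi>. A \<phi> \<theta>))"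
    using integral_swap_continuous[of "-pi" "-pi/2" pi "pi/2" A] contA by (simp add: cbox_interval case_prod_unfold)
  finally have A0: "integral sph_box (\<lambda>z. A (fst z) (snd z)) = 0" by (simp add: intA)
  have "(\<integral>x. rot_deriv a f x \<partial>area_measure) = integral sph_box (\<lambda>z. A (fst z) (snd z) - B (fst z) (snd z))"
    using area_integral(2)[OF smooth_on_imp_continuous_on[OF smooth_on_rot_deriv[OF f]], of a]
    by (simp add: AB[symmetric])
  also have "\<dots> = 0"
    using A0 B0 by (subst integral_diff) (auto simp: sph_box_def intro!: integrable_continuous contA contB)
  finally show ?thesis .
qed

section \<open>Green's formula\<close>

lemma continuous_on_laplace_beltrami: "smooth_on S2 f \<Longrightarrow> continuous_on S2 (laplace_beltrami f)"
  by (rule continuous_on_eq[where f = "\<lambda>x. \<Sum>i\<in>UNIV. rot_deriv (axis i 1) (rot_deriv (axis i 1) f) x"])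
    (auto intro!: smooth_on_imp_continuous_on smooth_on_sum smooth_on_rot_deriv simp: laplace_beltrami_rot_deriv)

text \<open>Each generator D is integrated by parts: D (u * D v) has integral zero and is expanded
  by the product rule. The right-hand side is symmetric in \<open>u\<close> and \<open>v\<close>,
  whence the Laplacian is symmetric.\<close>

lemma integral_mult_laplace_beltrami:
  assumes u: "smooth_on S2 u" and v: "smooth_on S2 v"
  shows "(\<integral>x. u x * laplace_beltrami v x \<partial>area_measure)
    = - (\<Sum>i\<in>UNIV. \<integral>x. rot_deriv (axis i 1) u x * rot_deriv (axis i 1) v x \<partial>area_measure)"
proof -
  let ?D = "\<lambda>i. rot_deriv (axis i 1)"
  note sm = smooth_on_rot_deriv smooth_on_mult u v
  have int: "integrable area_measure f" if "smooth_on S2 f" for f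
    by (rule area_integral) (rule smooth_on_imp_continuous_on[OF that])
  have ibp: "(\<integral>x. u x * ?D i (?D i v) x \<partial>area_measure) = - (\<integral>x. ?D i u x * ?D i v x \<partial>area_measure)" for i
  proof -
    have "0 = (\<integral>x. ?D i (\<lambda>x. u x * ?D i v x) x \<partial>area_measure)"
      by (rule integral_rot_deriv[symmetric]) (intro sm)
    also have "\<dots> = (\<integral>x. u x * ?D i (?D i v) x + ?D i u x * ?D i v x \<partial>area_measure)"
      by (intro Bochner_Integration.integral_cong refl rot_deriv_mult) (auto intro: sm simp: space_area_measure)
    also have "\<dots> = (\<integral>x. u x * ?D i (?D i v) x \<partial>area_measure) + (\<integral>x. ?D i u x * ?D i v x \<partial>area_measure)"
      by (intro Bochner_Integration.integral_add int sm)
    finally show ?thesis by simp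
  qed
  have "(\<integral>x. u x * laplace_beltrami v x \<partial>area_measure) = (\<integral>x. (\<Sum>i\<in>UNIV. u x * ?D i (?D i v) x) \<partial>area_measure)"
    by (intro Bochner_Integration.integral_cong refl) (simp add: space_area_measure laplace_beltrami_rot_deriv[OF v] sum_distrib_left)
  also have "\<dots> = (\<Sum>i\<in>UNIV. \<integral>x. u x * ?D i (?D i v) x \<partial>area_measure)"
    by (intro Bochner_Integration.integral_sum int sm)
  finally show ?thesis by (simp add: ibp sum_negf)
qed

lemma laplace_beltrami_symmetric:
  assumes "smooth_on S2 u" "smooth_on S2 v"
  shows "(\<integral>x. u x * laplace_beltrami v x \<partial>area_measure) = (\<integral>x. laplace_beltrami u x * v x \<partial>area_measure)"
  using integral_mult_laplace_beltrami[OF assms] integral_mult_laplace_beltrami[OF assms(2,1)]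
  by (simp add: mult.commute)

lemma integral_laplace_beltrami:
  assumes "smooth_on S2 u"
  shows "(\<integral>x. laplace_beltrami u x \<partial>area_measure) = 0"
proof -
  have "rot_deriv a (\<lambda>x. 1) x = 0" if "x \<in> S2" for a x
    using rot_deriv_extension[OF that has_derivative_const[of 1], of "\<lambda>x. 1" a] by simp
  then have "(\<integral>x. rot_deriv (axis i 1) (\<lambda>x. 1) x * rot_deriv (axis i 1) u x \<partial>area_measure) = (\<integral>x. 0 \<partial>area_measure)" for i
    by (intro Bochner_Integration.integral_cong) (auto simp: space_area_measure)
  then show ?thesis
    using integral_mult_laplace_beltrami[OF smooth_on_const[of _ 1] assms] by simp
qed


section \<open>The Poisson equation\<close>

lemma grad_eq_tangential_part:
  assumes "x \<in> S2" "(F has_derivative (\<lambda>v. P \<bullet> v)) (at x)" "\<And>y. y \<in> S2 \<Longrightarrow> F y = f y"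
  shows "grad f x = P - (P \<bullet> x) *\<^sub>R x"
proof -
  have "grad f x \<bullet> v = (P - (P \<bullet> x) *\<^sub>R x) \<bullet> v" for v
    using grad_extension[OF assms, of v]
    by (simp add: inner_diff_left inner_diff_right mult.commute)
  then show ?thesis
    using vector_eq_rdot by blast
qed

lemma inner_self_S2: "x \<in> S2 \<Longrightarrow> x \<bullet> x = 1"
  by (simp add: norm_eq_1)

text \<open>The derivative of a field h (l \<bullet> y) (l - (l \<bullet> y) y) at x has this shape,
  with c and d the values of h' and h. Linear functions are the case c = 0, d = 1; powers use both
  terms.\<close>

lemma trace_inner_scaleR:
  fixes l p x :: "real^3"
  shows "(\<Sum>i\<in>UNIV. ((c * (l \<bullet> axis i 1)) *\<^sub>R p + d *\<^sub>R (- ((l \<bullet> axis i 1) *\<^sub>R x) - s *\<^sub>R axis i 1)) $ i)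
    = c * (l \<bullet> p) - d * (l \<bullet> x) - 3 * d * s"
  by (simp add: inner_axis sum_3 inner_3 axis_3_components algebra_simps)

lemma laplace_beltrami_linear:
  assumes "x \<in> S2"
  shows "laplace_beltrami (\<lambda>x. l \<bullet> x) x = - 2 * (l \<bullet> x)"
proof -
  let ?W = "\<lambda>y. l - (l \<bullet> y) *\<^sub>R y"
  have g: "?W y = grad (\<lambda>x. l \<bullet> x) y" if "y \<in> S2" for y
    by (rule grad_eq_tangential_part[OF that, of "\<lambda>x. l \<bullet> x", symmetric])
       (auto intro!: derivative_eq_intros)
  have "(?W has_derivative (\<lambda>v. - ((l \<bullet> v) *\<^sub>R x) - (l \<bullet> x) *\<^sub>R v)) (at x)"
    by (auto intro!: derivative_eq_intros simp: fun_eq_iff algebra_simps)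
  from divergence_extension[OF assms this g]
  have "laplace_beltrami (\<lambda>x. l \<bullet> x) x = - 4 * (l \<bullet> x) - (- ((l \<bullet> x) *\<^sub>R x) - (l \<bullet> x) *\<^sub>R x) \<bullet> x"
    using trace_inner_scaleR[where c = 0 and d = 1 and l = l and x = x and s = "l \<bullet> x"]
    by (simp add: laplace_beltrami_def)
  then show ?thesis
    unfolding inner_diff_left inner_minus_left inner_scaleR_left inner_self_S2[OF assms] by simp
qed

lemma has_derivative_inner_power:
  "((\<lambda>x. (a \<bullet> x) ^ Suc n) has_derivative (\<lambda>v. real (Suc n) * (a \<bullet> y) ^ n * (a \<bullet> v))) (at y)"
  by (rule has_derivative_eq_rhs, rule has_derivative_power, rule bounded_linear_imp_has_derivative,
      rule bounded_linear_inner_right) (simp add: fun_eq_iff)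

text \<open>The exponent is written as k + 2 to avoid truncated subtraction in the term of lower
  degree. The field \<open>?W\<close> equals the gradient on the sphere and is polynomial in space,
  so it serves as the extension for the divergence.\<close>

lemma laplace_beltrami_linear_power:
  assumes a: "norm a = 1" and x: "x \<in> S2"
  shows "laplace_beltrami (\<lambda>x. (a \<bullet> x) ^ Suc (Suc k)) x
    = real (Suc (Suc k)) * (real (Suc k) * (a \<bullet> x) ^ k) - real (Suc (Suc k)) * (real (k + 3) * (a \<bullet> x) ^ Suc (Suc k))"
proof -
  define s where "s = a \<bullet> x"
  let ?n = "real (Suc (Suc k))"
  let ?W = "\<lambda>y. (?n * (a \<bullet> y) ^ Suc k) *\<^sub>R (a - (a \<bullet> y) *\<^sub>R y)"
  have g: "?W y = grad (\<lambda>x. (a \<bullet> x) ^ Suc (Suc k)) y" if "y \<in> S2" for y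
  proof -
    have "((\<lambda>x. (a \<bullet> x) ^ Suc (Suc k)) has_derivative (\<lambda>v. ((?n * (a \<bullet> y) ^ Suc k) *\<^sub>R a) \<bullet> v)) (at y)"
      by (rule has_derivative_eq_rhs[OF has_derivative_inner_power]) (simp only: inner_scaleR_left)
    from grad_eq_tangential_part[OF that this refl] show ?thesis
      by (simp only: scaleR_diff_right inner_scaleR_left scaleR_scaleR)
  qed
  have lin: "((\<lambda>y. a - (a \<bullet> y) *\<^sub>R y) has_derivative (\<lambda>v. - ((a \<bullet> v) *\<^sub>R x) - s *\<^sub>R v)) (at x)"
    unfolding s_def by (auto intro!: derivative_eq_intros simp: fun_eq_iff algebra_simps)
  define c where "c = ?n * (real (Suc k) * s ^ k)"
  define d where "d = ?n * s ^ Suc k"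
  have "(?W has_derivative (\<lambda>v. (c * (a \<bullet> v)) *\<^sub>R (a - s *\<^sub>R x)
      + d *\<^sub>R (- ((a \<bullet> v) *\<^sub>R x) - s *\<^sub>R v))) (at x)" (is "(_ has_derivative ?W') _")
    unfolding s_def c_def d_def
    by (rule has_derivative_eq_rhs, rule has_derivative_scaleR, rule has_derivative_mult_right,
        rule has_derivative_inner_power, rule lin)
       (simp only: fun_eq_iff s_def mult.assoc add.commute simp_thms)
  from divergence_extension[OF x this g]
  have L: "laplace_beltrami (\<lambda>x. (a \<bullet> x) ^ Suc (Suc k)) x = (\<Sum>i\<in>UNIV. ?W' (axis i 1) $ i) - ?W' x \<bullet> x"
    by (simp only: laplace_beltrami_def)
  have aa: "a \<bullet> a = 1" using a by (simp add: norm_eq_1)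
  have xx: "x \<bullet> x = 1" by (rule inner_self_S2[OF x])
  have "?W' x \<bullet> x = - 2 * d * s"
    unfolding inner_diff_left inner_add_left inner_minus_left inner_scaleR_left xx s_def[symmetric] by simp
  then have "laplace_beltrami (\<lambda>x. (a \<bullet> x) ^ Suc (Suc k)) x = c * (1 - s * s) - 2 * d * s"
    unfolding L trace_inner_scaleR by (simp add: inner_diff_right aa s_def[symmetric] algebra_simps)
  also have "\<dots> = ?n * (real (Suc k) * s ^ k) - ?n * (real (k + 3) * s ^ Suc (Suc k))"
    by (simp add: c_def d_def algebra_simps)
  finally show ?thesis unfolding s_def .
qed

lemma C_k_on_power:
  assumes "open U" "C_k_on k f U"
  shows "C_k_on k (\<lambda>x. f x ^ n) U"
  by (induction n) (auto intro: C_k_on_mult assms)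

lemma smooth_on_linear_power: "smooth_on A (\<lambda>x. (a \<bullet> x) ^ n)"
  by (rule smooth_onI[of UNIV])
     (auto intro: C_k_on_power C_k_on_linear bounded_linear_inner_right)

text \<open>A function orthogonal to the range of the Laplacian and to the constants is orthogonal to all
  zonal polynomials \<open>F (a \<bullet> x)\<close>, since \<open>\<Delta> s\<^sup>k = k (k - 1) s\<^sup>k\<^sup>-\<^sup>2 - k (k + 1) s\<^sup>k\<close> for \<open>s = a \<bullet> x\<close>;
  letting \<open>F\<close> concentrate at 1 shows that it vanishes at \<open>a\<close>.\<close>

lemma integral_zonal_power_eq_0:
  assumes u: "continuous_on S2 u" "(\<integral>x. u x \<partial>area_measure) = 0"
    and lap: "\<And>\<phi>. smooth_on S2 \<phi> \<Longrightarrow> (\<integral>x. u x * laplace_beltrami \<phi> x \<partial>area_measure) = 0"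
    and a: "norm a = 1"
  shows "(\<integral>x. u x * (a \<bullet> x) ^ k \<partial>area_measure) = 0"
proof (induction k rule: induct_nat_012)
  case 0
  then show ?case using u(2) by simp
next
  case 1
  have "(\<integral>x. u x * laplace_beltrami (\<lambda>x. a \<bullet> x) x \<partial>area_measure) = (\<integral>x. - 2 * (u x * (a \<bullet> x)) \<partial>area_measure)"
    by (intro Bochner_Integration.integral_cong) (auto simp: space_area_measure laplace_beltrami_linear)
  then show ?case
    using lap[OF smooth_on_linear[OF bounded_linear_inner_right, of S2 a]] by simp
next
  case (ge2 n)
  have int: "integrable area_measure (\<lambda>x. u x * (a \<bullet> x) ^ k)" for k
    by (rule area_integral) (intro continuous_intros u)
  let ?m = "real (Suc (Suc n))"
  have "0 = (\<integral>x. u x * laplace_beltrami (\<lambda>x. (a \<bullet> x) ^ Suc (Suc n)) x \<partial>area_measure)"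
    by (rule lap[symmetric]) (rule smooth_on_linear_power)
  also have "\<dots> = (\<integral>x. ?m * (real (Suc n) * (u x * (a \<bullet> x) ^ n)) - ?m * (real (n + 3) * (u x * (a \<bullet> x) ^ Suc (Suc n))) \<partial>area_measure)"
    by (intro Bochner_Integration.integral_cong refl)
       (simp only: space_area_measure laplace_beltrami_linear_power[OF a] right_diff_distrib mult.left_commute)
  also have "\<dots> = ?m * (real (Suc n) * (\<integral>x. u x * (a \<bullet> x) ^ n \<partial>area_measure))
      - ?m * (real (n + 3) * (\<integral>x. u x * (a \<bullet> x) ^ Suc (Suc n) \<partial>area_measure))"
    by (subst Bochner_Integration.integral_diff)
       (intro Bochner_Integration.integrable_mult_right int, intro Bochner_Integration.integrable_mult_right int,
        simp only: integral_mult_right_zero)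
  \<comment> \<open>The factor (n + 2)(n + 3) of the higher moment is nonzero, so that moment
    vanishes with moment n. The step by two is why moments 0 and 1 are both base cases.\<close>
  finally show ?case using ge2(1) by simp
qed

text \<open>Polynomials are uniformly dense in the continuous functions on [-1, 1], which contains
  all values of a \<bullet> x, and their integrals against u vanish by the moments.\<close>

lemma integral_zonal_eq_0:
  assumes u: "continuous_on S2 u" "(\<integral>x. u x \<partial>area_measure) = 0"
    and lap: "\<And>\<phi>. smooth_on S2 \<phi> \<Longrightarrow> (\<integral>x. u x * laplace_beltrami \<phi> x \<partial>area_measure) = 0"
    and a: "norm a = 1" and F: "continuous_on {-1..1} F"
  shows "(\<integral>x. u x * F (a \<bullet> x) \<partial>area_measure) = 0"
proof -
  have ax: "a \<bullet> x \<in> {-1..1}" if "x \<in> S2" for x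
    using Cauchy_Schwarz_ineq2[of a x] a that by (auto simp: abs_le_iff)
  have cF: "continuous_on S2 (\<lambda>x. F (a \<bullet> x))"
    using ax by (intro continuous_on_compose2[OF F] continuous_intros) auto
  have "\<bar>\<integral>x. u x * F (a \<bullet> x) \<partial>area_measure\<bar> \<le> 0"
  proof (rule field_le_epsilon)
    fix e :: real assume e: "e > 0"
    define K where "K = (\<integral>x. \<bar>u x\<bar> \<partial>area_measure)"
    have K: "K \<ge> 0" by (simp add: K_def)
    \<comment> \<open>Dividing by K + 1 instead of K also covers K = 0.\<close>
    then obtain g where g: "real_polynomial_function g" "\<And>s. s \<in> {-1..1} \<Longrightarrow> \<bar>F s - g s\<bar> < e / (K + 1)"
      using Stone_Weierstrass_real_polynomial_function[OF _ F, of "e / (K + 1)"] e by auto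
    then obtain c n where gc: "g = (\<lambda>s. \<Sum>i\<le>n. c i * s ^ i)"
      using real_polynomial_function_iff_sum by blast
    have cg: "continuous_on S2 (\<lambda>x. g (a \<bullet> x))"
      unfolding gc by (intro continuous_intros)
    have int: "integrable area_measure h" if "continuous_on S2 h" for h :: "real^3 \<Rightarrow> real"
      by (rule area_integral[OF that])
    have "(\<integral>x. u x * g (a \<bullet> x) \<partial>area_measure) = (\<integral>x. (\<Sum>i\<le>n. c i * (u x * (a \<bullet> x) ^ i)) \<partial>area_measure)"
      by (simp add: gc sum_distrib_left mult_ac)
    also have "\<dots> = (\<Sum>i\<le>n. c i * (\<integral>x. u x * (a \<bullet> x) ^ i \<partial>area_measure))"
      by (subst Bochner_Integration.integral_sum) (auto intro!: int continuous_intros u)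
    also have "\<dots> = 0"
      by (simp add: integral_zonal_power_eq_0[OF u lap a])
    finally have "(\<integral>x. u x * F (a \<bullet> x) \<partial>area_measure) = (\<integral>x. u x * (F (a \<bullet> x) - g (a \<bullet> x)) \<partial>area_measure)"
      by (subst right_diff_distrib, subst Bochner_Integration.integral_diff) (auto intro!: int continuous_intros u cF cg)
    also have "\<bar>\<dots>\<bar> \<le> (\<integral>x. \<bar>u x\<bar> * (e / (K + 1)) \<partial>area_measure)"
    proof (rule order_trans[OF integral_abs_bound], rule integral_mono)
      show "\<bar>u x * (F (a \<bullet> x) - g (a \<bullet> x))\<bar> \<le> \<bar>u x\<bar> * (e / (K + 1))" if "x \<in> space area_measure" for x
        unfolding abs_mult using g(2)[OF ax] that by (intro mult_left_mono) (auto simp: space_area_measure less_imp_le)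
    qed (intro int continuous_intros u cF cg; simp)+
    also have "\<dots> = K * (e / (K + 1))" by (simp add: K_def)
    also have "\<dots> \<le> e" using K e by (simp add: field_simps)
    finally show "\<bar>\<integral>x. u x * F (a \<bullet> x) \<partial>area_measure\<bar> \<le> 0 + e" by simp
  qed
  then show ?thesis by simp
qed

lemma weakly_harmonic_eq_0:
  assumes u: "continuous_on S2 u" "(\<integral>x. u x \<partial>area_measure) = 0"
    and lap: "\<And>\<phi>. smooth_on S2 \<phi> \<Longrightarrow> (\<integral>x. u x * laplace_beltrami \<phi> x \<partial>area_measure) = 0"
    and a: "a \<in> S2"
  shows "u a = 0"
proof (rule ccontr)
  assume ne: "u a \<noteq> 0"
  have na: "norm a = 1" using a by simp
  \<comment> \<open>The factor \<open>u a\<close> replaces a distinction by the sign of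
    \<open>u a\<close>: the product is positive near \<open>a\<close> in either case.\<close>
  have u2: "continuous_on S2 (\<lambda>x. u a * u x)" by (intro continuous_intros u)
  have "0 < u a * u a" using ne by (metis power2_eq_square zero_less_power2)
  then obtain d where d: "d > 0" "\<And>x. x \<in> S2 \<Longrightarrow> dist x a < d \<Longrightarrow> u a * u x > 0"
  proof -
    assume pos: "0 < u a * u a" and *: "\<And>d. d > 0 \<Longrightarrow> (\<And>x. x \<in> S2 \<Longrightarrow> dist x a < d \<Longrightarrow> u a * u x > 0) \<Longrightarrow> thesis"
    obtain d where d: "d > 0" "\<And>x. x \<in> S2 \<Longrightarrow> dist x a < d \<Longrightarrow> dist (u a * u x) (u a * u a) < u a * u a"
      using u2 a pos unfolding continuous_on_iff by metis
    have "u a * u x > 0" if "x \<in> S2" "dist x a < d" for x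
      using d(2)[OF that] by (auto simp: dist_real_def abs_less_iff)
    then show thesis using * d(1) by blast
  qed
  \<comment> \<open>As |x - a|^2 = 2 - 2 (a \<bullet> x), this hinge is supported in the cap of
    radius d about a, where the product with \<open>u a\<close> is positive. It is only continuous,
    hence the approximation by polynomials.\<close>
  define F where "F s = max 0 (s - (1 - d\<^sup>2 / 2))" for s :: real
  have F0: "F s \<ge> 0" for s by (simp add: F_def)
  have cF: "continuous_on T F" for T unfolding F_def by (intro continuous_intros)
  have c: "continuous_on S2 (\<lambda>x. u a * u x * F (a \<bullet> x))"
    by (intro continuous_intros u continuous_on_compose2[OF cF[of UNIV]]) auto
  have "(\<integral>x. u a * u x * F (a \<bullet> x) \<partial>area_measure) = u a * (\<integral>x. u x * F (a \<bullet> x) \<partial>area_measure)"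
    by (simp add: mult.assoc)
  also have "\<dots> = 0" using integral_zonal_eq_0[OF u lap na cF] by simp
  finally have "u a * u a * F (a \<bullet> a) = 0"
  proof (rule area_integral_nonneg_eq_0[OF c _ _ a, rotated])
    show "u a * u x * F (a \<bullet> x) \<ge> 0" if x: "x \<in> S2" for x
    proof (cases "dist x a < d")
      case True
      then show ?thesis using d(2)[OF x True] F0 by (simp add: less_imp_le)
    next
      case False
      have "(dist x a)\<^sup>2 = 2 - 2 * (a \<bullet> x)"
        using inner_self_S2[OF x] inner_self_S2[OF a]
        by (simp add: dist_norm power2_norm_eq_inner inner_diff_left inner_diff_right inner_commute)
      moreover have "d\<^sup>2 \<le> (dist x a)\<^sup>2" using False d(1) by (intro power_mono) auto
      ultimately have "F (a \<bullet> x) = 0" by (simp add: F_def)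
      then show ?thesis by simp
    qed
  qed
  moreover have "F (a \<bullet> a) > 0" using inner_self_S2[OF a] d(1) by (simp add: F_def)
  ultimately show False using ne by simp
qed

text \<open>Existence takes r = 2. A competitor may come with another exponent, but uniqueness uses
  only its continuity, its mean and the weak equation, tested with smooth functions; the exponents
  never have to be compared.\<close>

lemma \<G>_eqI:
  assumes u: "smooth_on S2 u" and f: "smooth_on S2 f"
    and lap: "\<And>x. x \<in> S2 \<Longrightarrow> - laplace_beltrami u x = f x"
    and zm: "zero_mean u"
  shows "\<G> f = restrict u S2"
  unfolding \<G>_def
proof (rule the_equality)
  let ?u = "restrict u S2"
  have eq: "?u x = u x" if "x \<in> S2" for x using that by simp
  have int_eq: "(\<integral>x. g (?u x) x \<partial>area_measure) = (\<integral>x. g (u x) x \<partial>area_measure)" for g :: "real \<Rightarrow> real^3 \<Rightarrow> real"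
    by (intro Bochner_Integration.integral_cong) (auto simp: space_area_measure)
  have su: "smooth_on S2 ?u" by (rule smooth_on_cong[OF u]) simp
  have cu: "continuous_on S2 ?u" by (rule smooth_on_imp_continuous_on[OF su])
  have Lp: "h \<in> Lp 2" if "smooth_on S2 h" for h
  proof -
    have "integrable area_measure (\<lambda>x. \<bar>h x\<bar> powr 2)"
      by (rule area_integral) (auto intro!: continuous_intros continuous_on_powr' smooth_on_imp_continuous_on[OF that])
    then show ?thesis
      using measurable_area_measure[OF smooth_on_imp_continuous_on[OF that]] by (simp add: Lp_def)
  qed
  have z: "Lp_norm 2 (\<lambda>x. 0) = 0" by (simp add: Lp_norm_def)
  have g0: "grad (\<lambda>x. 0) x = 0" for x
    by (simp add: grad_def vec_eq_iff)
  have s0: "sobolev2_norm 2 (\<lambda>x. 0) = 0"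
    by (simp add: sobolev2_norm_def g0 z)
  \<comment> \<open>A smooth function is approximated by the constant sequence.\<close>
  have sob: "?u \<in> sobolev2 2"
    unfolding sobolev2_def using Lp[OF su] su z s0
    by (auto intro!: exI[of _ "\<lambda>n. ?u"])
  \<comment> \<open>Green's formula for the smooth \<open>u\<close> eliminates \<open>f\<close>, so
    that the difference of two weak solutions annihilates the range of the Laplacian.\<close>
  have weak: "weak_poisson v f \<longleftrightarrow> (\<forall>\<phi>. smooth_on S2 \<phi> \<longrightarrow>
      (\<integral>x. v x * laplace_beltrami \<phi> x \<partial>area_measure) = (\<integral>x. u x * laplace_beltrami \<phi> x \<partial>area_measure))" for v
  proof -
    have "(\<integral>x. f x * \<phi> x \<partial>area_measure) = - (\<integral>x. u x * laplace_beltrami \<phi> x \<partial>area_measure)"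
      if "smooth_on S2 \<phi>" for \<phi>
    proof -
      have "(\<integral>x. f x * \<phi> x \<partial>area_measure) = (\<integral>x. - (laplace_beltrami u x * \<phi> x) \<partial>area_measure)"
        by (intro Bochner_Integration.integral_cong) (auto simp: space_area_measure lap[symmetric])
      then show ?thesis using laplace_beltrami_symmetric[OF u that] by simp
    qed
    then show ?thesis unfolding weak_poisson_def by (simp cong: imp_cong)
  qed
  have "weak_poisson ?u f" unfolding weak using int_eq[of "\<lambda>a x. a * _ x"] by simp
  moreover have "zero_mean ?u" using zm int_eq[of "\<lambda>a x. a"] by (simp add: zero_mean_def)
  ultimately show "?u \<in> extensional S2 \<and> continuous_on S2 ?u \<and> zero_mean ?u \<and>
     (\<exists>r>1. f \<in> Lp r \<and> ?u \<in> sobolev2 r \<and> weak_poisson ?u f)"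
    using cu sob Lp[OF f] by (auto intro!: exI[of _ 2])
  fix v assume v: "v \<in> extensional S2 \<and> continuous_on S2 v \<and> zero_mean v \<and>
     (\<exists>r>1. f \<in> Lp r \<and> v \<in> sobolev2 r \<and> weak_poisson v f)"
  have uc: "continuous_on S2 u" by (rule smooth_on_imp_continuous_on[OF u])
  have "v x - u x = 0" if "x \<in> S2" for x
  proof (rule weakly_harmonic_eq_0[where u = "\<lambda>x. v x - u x", OF _ _ _ that])
    show "continuous_on S2 (\<lambda>x. v x - u x)" using v uc by (intro continuous_intros) auto
    show "(\<integral>x. v x - u x \<partial>area_measure) = 0"
      using v zm uc by (subst Bochner_Integration.integral_diff) (auto simp: zero_mean_def intro!: area_integral)
    show "(\<integral>x. (v x - u x) * laplace_beltrami \<phi> x \<partial>area_measure) = 0" if "smooth_on S2 \<phi>" for \<phi>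
      unfolding left_diff_distrib using v weak that uc continuous_on_laplace_beltrami[OF that]
      by (subst Bochner_Integration.integral_diff) (auto intro!: area_integral continuous_intros)
  qed
  then show "v = ?u" using v by (auto simp: extensional_def restrict_def)
qed


section \<open>Rotations and explicit solutions\<close>

lemma grad_cong:
  assumes "smooth_on S2 f" "\<And>y. y \<in> S2 \<Longrightarrow> f y = g y" "x \<noteq> 0"
  shows "grad g x = grad f x"
proof (rule grad_eqI, rule has_derivative_transform_within_open)
  show "(radial_ext f has_derivative (\<lambda>v. grad f x \<bullet> v)) (at x)"
    by (rule has_derivative_radial_ext) fact+
  show "radial_ext f y = radial_ext g y" if "y \<in> -{0}" for y
    using assms(2)[OF radial_projection_on_sphere[of y]] that by (simp add: radial_ext_def)
qed (use assms(3) in auto)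

lemma laplace_beltrami_cong:
  assumes f: "smooth_on S2 f" and fg: "\<And>y. y \<in> S2 \<Longrightarrow> f y = g y" and x: "x \<in> S2"
  shows "laplace_beltrami g x = laplace_beltrami f x"
proof -
  have "x \<noteq> 0" using x by auto
  then obtain G' where G: "(grad f has_derivative G') (at x)"
    using has_derivative_grad[OF f] by blast
  have eq: "grad f y = grad g y" if "y \<in> S2" for y
    by (rule grad_cong[OF f fg, symmetric]) (use that in auto)
  show ?thesis
    unfolding laplace_beltrami_eq[OF x G] laplace_beltrami_def[of g]
    by (rule divergence_extension[OF x G eq])
qed

lemma smooth_on_lincomb:
  assumes "smooth_on S2 f" "smooth_on S2 g"
  shows "smooth_on S2 (\<lambda>x. a * f x + b * g x)"
  by (intro smooth_on_add smooth_on_mult smooth_on_const assms)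

lemma grad_lincomb:
  assumes "smooth_on S2 f" "smooth_on S2 g" "x \<noteq> 0"
  shows "grad (\<lambda>x. a * f x + b * g x) x = a *\<^sub>R grad f x + b *\<^sub>R grad g x"
proof (rule grad_eqI)
  have "((\<lambda>x. a * radial_ext f x + b * radial_ext g x) has_derivative (\<lambda>v. a * (grad f x \<bullet> v) + b * (grad g x \<bullet> v))) (at x)"
    by (intro has_derivative_add has_derivative_mult_right has_derivative_radial_ext assms)
  then show "(radial_ext (\<lambda>x. a * f x + b * g x) has_derivative (\<lambda>v. (a *\<^sub>R grad f x + b *\<^sub>R grad g x) \<bullet> v)) (at x)"
    by (simp add: radial_ext_def[abs_def] inner_add_left)
qed

lemma laplace_beltrami_lincomb:
  assumes "smooth_on S2 f" "smooth_on S2 g" "x \<in> S2"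
  shows "laplace_beltrami (\<lambda>x. a * f x + b * g x) x = a * laplace_beltrami f x + b * laplace_beltrami g x"
proof -
  have x: "x \<noteq> 0" using assms(3) by auto
  obtain F' where F: "(grad f has_derivative F') (at x)" using has_derivative_grad[OF assms(1) x] .
  obtain G' where G: "(grad g has_derivative G') (at x)" using has_derivative_grad[OF assms(2) x] .
  have "((\<lambda>y. a *\<^sub>R grad f y + b *\<^sub>R grad g y) has_derivative (\<lambda>v. a *\<^sub>R F' v + b *\<^sub>R G' v)) (at x)"
    by (intro has_derivative_add has_derivative_scaleR_right F G)
  then have "laplace_beltrami (\<lambda>x. a * f x + b * g x) x
    = (\<Sum>i\<in>UNIV. (a *\<^sub>R F' (axis i 1) + b *\<^sub>R G' (axis i 1)) $ i) - (a *\<^sub>R F' x + b *\<^sub>R G' x) \<bullet> x"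
    unfolding laplace_beltrami_def
    by (rule divergence_extension[OF assms(3)]) (rule grad_lincomb[OF assms(1,2), symmetric], auto)
  then show ?thesis
    by (simp add: laplace_beltrami_eq[OF assms(3) F] laplace_beltrami_eq[OF assms(3) G]
        sum.distrib inner_add_left right_diff_distrib sum_distrib_left)
qed

section \<open>Equivariance under orthogonal maps\<close>

lemma radial_ext_orthogonal:
  assumes "orthogonal_transformation B"
  shows "radial_ext (\<lambda>x. f (B x)) y = radial_ext f (B y)"
proof -
  have "linear B" "norm (B y) = norm y"
    using assms by (auto simp: orthogonal_transformation orthogonal_transformation_linear)
  then show ?thesis by (simp add: radial_ext_def linear_scale)
qed

lemma orthogonal_transformation_nonzero:
  fixes x :: "'a::euclidean_space"
  assumes "orthogonal_transformation B" "x \<noteq> 0"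
  shows "B x \<noteq> 0"
  using assms orthogonal_transformation_norm by (metis norm_eq_zero)

lemma orthogonal_transformation_image_nonzero:
  fixes B :: "'a::euclidean_space \<Rightarrow> 'a"
  assumes "orthogonal_transformation B"
  shows "B ` (-{0}) \<subseteq> -{0}"
proof (rule image_subsetI)
  show "B x \<in> -{0}" if "x \<in> -{0}" for x
    using orthogonal_transformation_nonzero[OF assms, of x] that by simp
qed

lemma grad_orthogonal:
  assumes B: "orthogonal_transformation B" and f: "smooth_on S2 f" and x: "x \<noteq> 0"
  shows "grad (\<lambda>x. f (B x)) x = adjoint B (grad f (B x))"
proof (rule grad_eqI)
  have lin: "linear B" by (rule orthogonal_transformation_linear[OF B])
  have "(B has_derivative B) (at x)"
    using lin by (simp add: bounded_linear_imp_has_derivative linear_conv_bounded_linear)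
  then have "((\<lambda>y. radial_ext f (B y)) has_derivative (\<lambda>v. grad f (B x) \<bullet> B v)) (at x)"
    using has_derivative_compose[of B B x UNIV "radial_ext f"]
      has_derivative_radial_ext[OF f orthogonal_transformation_nonzero[OF B x]] by blast
  then show "(radial_ext (\<lambda>x. f (B x)) has_derivative (\<lambda>v. adjoint B (grad f (B x)) \<bullet> v)) (at x)"
    unfolding radial_ext_orthogonal[OF B, abs_def] by (simp add: adjoint_clauses[OF lin])
qed

lemma smooth_on_orthogonal:
  assumes B: "orthogonal_transformation B" and f: "smooth_on S2 f"
  shows "smooth_on S2 (\<lambda>x. f (B x))"
proof (rule smooth_on_radial_ext)
  fix k
  have lin: "bounded_linear B" using orthogonal_transformation_linear[OF B] by (simp add: linear_conv_bounded_linear)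
  show "C_k_on k (radial_ext (\<lambda>x. f (B x))) (- {0})"
    unfolding radial_ext_orthogonal[OF B, abs_def]
  proof (rule C_k_on_compose[OF _ _ _ C_k_on_radial_ext[OF f]])
    show "C_k_on k (\<lambda>x. B x \<bullet> b) (- {0})" for b
      by (intro C_k_on_linear bounded_linear_compose[OF bounded_linear_inner_left lin]) auto
  qed (use orthogonal_transformation_image_nonzero[OF B] in auto)
qed

lemma trace_orthogonal_conjugate:
  fixes B M :: "real^'n \<Rightarrow> real^'n"
  assumes B: "orthogonal_transformation B" and M: "linear M"
  shows "(\<Sum>i\<in>UNIV. adjoint B (M (B (axis i 1))) $ i) = (\<Sum>i\<in>UNIV. M (axis i 1) $ i)"
proof -
  have lB: "linear B" by (rule orthogonal_transformation_linear[OF B])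
  then have lA: "linear (adjoint B)" by (rule adjoint_linear)
  have "(\<Sum>i\<in>UNIV. adjoint B (M (B (axis i 1))) $ i) = trace (matrix (adjoint B \<circ> M \<circ> B))"
    by (simp add: trace_def matrix_def)
  also have "\<dots> = trace (transpose (matrix B) ** matrix M ** matrix B)"
    using lB lA M by (simp add: matrix_compose linear_compose matrix_adjoint)
  also have "\<dots> = trace (matrix M ** matrix B ** transpose (matrix B))"
    by (metis matrix_mul_assoc trace_mul_sym)
  also have "\<dots> = trace (matrix M)"
    using B by (simp add: orthogonal_transformation_matrix orthogonal_matrix_def matrix_mul_assoc[symmetric])
  finally show ?thesis by (simp add: trace_def matrix_def)
qed

text \<open>The derivative of the gradient field is conjugated by \<open>B\<close>. This leaves its
  trace unchanged and moves its normal entry from x to B x.\<close>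

lemma laplace_beltrami_orthogonal:
  assumes B: "orthogonal_transformation B" and f: "smooth_on S2 f" and x: "x \<in> S2"
  shows "laplace_beltrami (\<lambda>x. f (B x)) x = laplace_beltrami f (B x)"
proof -
  have lB: "linear B" by (rule orthogonal_transformation_linear[OF B])
  then have lA: "linear (adjoint B)" by (rule adjoint_linear)
  have Bx: "B x \<in> S2" using x orthogonal_transformation_norm[OF B] by simp
  then have "B x \<noteq> 0" by auto
  then obtain G' where G: "(grad f has_derivative G') (at (B x))" using has_derivative_grad[OF f] by blast
  have "(B has_derivative B) (at x)"
    using lB by (simp add: bounded_linear_imp_has_derivative linear_conv_bounded_linear)
  then have "((\<lambda>y. grad f (B y)) has_derivative (\<lambda>v. G' (B v))) (at x)"
    using has_derivative_compose[of B B x UNIV "grad f"] G by blast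
  then have "((\<lambda>y. adjoint B (grad f (B y))) has_derivative (\<lambda>v. adjoint B (G' (B v)))) (at x)"
    by (rule bounded_linear.has_derivative[OF lA[unfolded linear_conv_bounded_linear]])
  then have "laplace_beltrami (\<lambda>x. f (B x)) x = (\<Sum>i\<in>UNIV. adjoint B (G' (B (axis i 1))) $ i) - adjoint B (G' (B x)) \<bullet> x"
    unfolding laplace_beltrami_def
    by (rule divergence_extension[OF x]) (rule grad_orthogonal[OF B f, symmetric], auto)
  then show ?thesis
    by (simp add: trace_orthogonal_conjugate[OF B has_derivative_linear[OF G]] adjoint_clauses[OF lB] laplace_beltrami_eq[OF Bx G])
qed

lemma zero_mean_eigenfunction:
  assumes "smooth_on S2 f" "\<And>x. x \<in> S2 \<Longrightarrow> laplace_beltrami f x = c * f x" "c \<noteq> 0"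
  shows "zero_mean f"
proof -
  have "(\<integral>x. c * f x \<partial>area_measure) = (\<integral>x. laplace_beltrami f x \<partial>area_measure)"
    by (intro Bochner_Integration.integral_cong) (auto simp: space_area_measure assms(2))
  then show ?thesis using integral_laplace_beltrami[OF assms(1)] assms(3) by (simp add: zero_mean_def)
qed

lemma zero_mean_lincomb:
  assumes "continuous_on S2 f" "continuous_on S2 g" "zero_mean f" "zero_mean g"
  shows "zero_mean (\<lambda>x. a * f x + b * g x)"
  using assms area_integral(1)[OF assms(1)] area_integral(1)[OF assms(2)]
  by (simp add: zero_mean_def)

text \<open>Rodrigues' formula; a rotation only if \<open>n\<close> is a unit vector.\<close>

definition rot :: "real^3 \<Rightarrow> real \<Rightarrow> real^3 \<Rightarrow> real^3" where
  "rot n \<alpha> x = cos \<alpha> *\<^sub>R x + sin \<alpha> *\<^sub>R cross3 n x + ((1 - cos \<alpha>) * (n \<bullet> x)) *\<^sub>R n"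

lemma cross3_cross3_unit:
  assumes "norm n = 1"
  shows "cross3 n (cross3 n x) = (n \<bullet> x) *\<^sub>R n - x"
proof -
  have "n$1 * n$1 + n$2 * n$2 + n$3 * n$3 = 1" using assms by (simp add: norm_eq_1 inner_3)
  then show ?thesis
    unfolding vec_eq_3 cross_components inner_3 vector_minus_component vector_scaleR_component real_scaleR_def
    by (intro conjI; algebra)
qed

lemma cross3_linear:
  "cross3 n (x + y) = cross3 n x + cross3 n y" "cross3 n (c *\<^sub>R x) = c *\<^sub>R cross3 n x"
  "cross3 n (x - y) = cross3 n x - cross3 n y"
  by (simp_all add: cross_add_right cross_mult_right Cross3.right_diff_distrib)

lemma linear_rot: "linear (rot n \<alpha>)"
  by (rule linearI) (simp_all add: rot_def cross3_linear inner_add_right algebra_simps)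

lemma rot_0 [simp]: "rot n 0 x = x"
  by (simp add: rot_def)

lemma rot_add:
  assumes "norm n = 1"
  shows "rot n \<alpha> (rot n \<beta> x) = rot n (\<alpha> + \<beta>) x"
proof -
  have nn: "n \<bullet> n = 1" using assms by (simp add: norm_eq_1)
  have "n \<bullet> rot n \<beta> x = n \<bullet> x"
    by (simp add: rot_def inner_add_right dot_cross_self nn algebra_simps)
  moreover have "cross3 n (rot n \<beta> x) = cos \<beta> *\<^sub>R cross3 n x + sin \<beta> *\<^sub>R ((n \<bullet> x) *\<^sub>R n - x)"
    by (simp add: rot_def cross3_linear cross3_cross3_unit[OF assms])
  ultimately have "rot n \<alpha> (rot n \<beta> x) = cos \<alpha> *\<^sub>R rot n \<beta> x
     + sin \<alpha> *\<^sub>R (cos \<beta> *\<^sub>R cross3 n x + sin \<beta> *\<^sub>R ((n \<bullet> x) *\<^sub>R n - x)) + ((1 - cos \<alpha>) * (n \<bullet> x)) *\<^sub>R n"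
    by (simp add: rot_def[of n \<alpha>])
  then show ?thesis
    by (simp add: rot_def cos_add sin_add algebra_simps)
qed

lemma inner_rot_rot:
  assumes "norm n = 1"
  shows "rot n \<alpha> x \<bullet> rot n \<alpha> y = x \<bullet> y"
proof -
  have nn: "n \<bullet> n = 1" using assms by (simp add: norm_eq_1)
  have 1: "cross3 n x \<bullet> y = - (x \<bullet> cross3 n y)" by (simp add: inner_3 cross_components algebra_simps)
  have 2: "cross3 n x \<bullet> cross3 n y = x \<bullet> y - (n \<bullet> x) * (n \<bullet> y)"
  proof -
    have "cross3 n x \<bullet> cross3 n y = - (x \<bullet> cross3 n (cross3 n y))" by (simp add: inner_3 cross_components algebra_simps)
    then show ?thesis by (simp add: cross3_cross3_unit[OF assms] inner_diff_right inner_commute)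
  qed
  define c s A P where "c = cos \<alpha>" and "s = sin \<alpha>" and "A = (n \<bullet> x) * (n \<bullet> y)" and "P = x \<bullet> y"
  have "rot n \<alpha> x \<bullet> rot n \<alpha> y = c * c * P + 2 * c * (1 - c) * A + s * s * (P - A) + (1 - c) * (1 - c) * A"
    unfolding rot_def inner_add_left inner_add_right inner_scaleR_left inner_scaleR_right 1 2 dot_cross_self nn
      c_def[symmetric] s_def[symmetric] inner_commute[of x n]
    by (simp add: A_def P_def algebra_simps)
  moreover have "c * c + s * s = 1"
    using sin_cos_squared_add2[of \<alpha>] by (simp add: c_def s_def power2_eq_square)
  ultimately show ?thesis unfolding P_def[symmetric] by algebra
qed

lemma orthogonal_transformation_rot: "norm n = 1 \<Longrightarrow> orthogonal_transformation (rot n \<alpha>)"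
  by (simp add: orthogonal_transformation_def linear_rot inner_rot_rot)

text \<open>A rotation is the square of the rotation by half the angle, so its determinant is the
  square of 1 or -1.\<close>

lemma det_rot:
  assumes n: "norm n = 1"
  shows "det (matrix (rot n \<alpha>)) = 1"
proof -
  have "rot n \<alpha> = rot n (\<alpha> / 2) \<circ> rot n (\<alpha> / 2)"
    by (simp add: fun_eq_iff rot_add[OF n])
  then have "det (matrix (rot n \<alpha>)) = det (matrix (rot n (\<alpha> / 2))) * det (matrix (rot n (\<alpha> / 2)))"
    by (metis det_mul linear_rot matrix_compose)
  moreover have "orthogonal_matrix (matrix (rot n (\<alpha> / 2)))"
    using orthogonal_transformation_rot[OF n] by (simp add: orthogonal_transformation_matrix)
  ultimately show ?thesis using det_orthogonal_matrix by fastforce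
qed

lemma rotation_matrix_rot: "norm n = 1 \<Longrightarrow> rotation_matrix (matrix (rot n \<alpha>))"
  using orthogonal_transformation_rot by (simp add: rotation_matrix_def det_rot orthogonal_transformation_matrix)

lemma rot_cross3:
  assumes "norm n = 1"
  shows "rot n \<alpha> (cross3 x y) = cross3 (rot n \<alpha> x) (rot n \<alpha> y)"
  using cross_rotation_matrix[OF rotation_matrix_rot[OF assms, of \<alpha>], of x y]
  by (simp add: matrix_works linear_rot linear_matrix_vector_mul_eq)

text \<open>The map \<open>cross3 n\<close> commutes with \<open>rot n\<close>, so the angular
  velocity can stand inside the rotation next to y'. In this form the rule applies twice in a row to
  nested rotations.\<close>

lemma has_vector_derivative_rot:
  assumes n: "norm n = 1" and y: "(y has_vector_derivative y') (at t)"
  shows "((\<lambda>t. rot n (b * t) (y t)) has_vector_derivative rot n (b * t) (b *\<^sub>R cross3 n (y t) + y')) (at t)"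
proof -
  have c: "((\<lambda>t. cross3 n (y t)) has_vector_derivative cross3 n y') (at t)"
    by (rule bounded_linear.has_vector_derivative[OF bounded_linear_cross3 y])
  have i: "((\<lambda>t. n \<bullet> y t) has_real_derivative n \<bullet> y') (at t)"
    using bounded_linear.has_vector_derivative[OF bounded_linear_inner_right y]
    by (simp add: has_real_derivative_iff_has_vector_derivative)
  have "((\<lambda>t. rot n (b * t) (y t)) has_vector_derivative
     (cos (b * t) *\<^sub>R y' + (- sin (b * t) * b) *\<^sub>R y t) + (sin (b * t) *\<^sub>R cross3 n y' + (cos (b * t) * b) *\<^sub>R cross3 n (y t))
     + ((sin (b * t) * b) * (n \<bullet> y t) + (n \<bullet> y') * (1 - cos (b * t))) *\<^sub>R n) (at t)"
    unfolding rot_def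
    by (intro has_vector_derivative_add has_vector_derivative_scaleR y c has_vector_derivative_scaleR[where g' = 0, THEN has_vector_derivative_eq_rhs])
      (auto intro!: derivative_eq_intros i)
  then show ?thesis
    by (rule has_vector_derivative_eq_rhs)
      (simp add: rot_def cross3_linear cross3_cross3_unit[OF n] inner_add_right dot_cross_self algebra_simps)
qed

text \<open>The hypothesis ranges over all \<open>v\<close>, not only basis vectors, because the
  triple product turns (n x h) \<bullet> v into h \<bullet> (v x n). The conclusion has the same
  form and can be iterated.\<close>

lemma C_k_on_rot:
  fixes h :: "'a::euclidean_space \<Rightarrow> real^3"
  assumes U: "open U" and g: "C_k_on k g U" and h: "\<And>v. C_k_on k (\<lambda>z. h z \<bullet> v) U"
  shows "C_k_on k (\<lambda>z. rot n (g z) (h z) \<bullet> v) U"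
proof -
  have "rot n (g z) (h z) \<bullet> v = cos (g z) * (h z \<bullet> v) + sin (g z) * (h z \<bullet> cross3 v n)
     + ((1 + (-1) * cos (g z)) * (h z \<bullet> n)) * (n \<bullet> v)" for z
    by (simp add: rot_def inner_3 cross_components algebra_simps)
  moreover have "C_k_on k (\<lambda>z. cos (g z)) U" "C_k_on k (\<lambda>z. sin (g z)) U"
    using C_k_on_sin_cos[OF U g] by auto
  ultimately show ?thesis
    by (simp only:) (intro C_k_on_add[OF U] C_k_on_mult[OF U] C_k_on_const h)
qed

text \<open>The solution with initial value \<kappa> (n \<bullet> x) + f x. In the frame turning
  with \<omega> about the third axis its linear part is steady, while \<open>f\<close> turns about
  the axis \<open>n\<close> of that linear part.\<close>

definition rotating_wave :: "real \<Rightarrow> real^3 \<Rightarrow> real \<Rightarrow> (real^3 \<Rightarrow> real) \<Rightarrow> real \<Rightarrow> real^3 \<Rightarrow> real" where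
  "rotating_wave \<omega> n \<kappa> f t x = \<kappa> * (n \<bullet> rot (axis 3 1) (\<omega> * t) x)
     + f (rot n ((- \<kappa> / 3) * t) (rot (axis 3 1) (\<omega> * t) x))"

lemma smooth_solution_rotating_wave:
  assumes n: "norm n = 1" and f: "smooth_on S2 f" "\<And>x. x \<in> S2 \<Longrightarrow> - laplace_beltrami f x = 6 * f x"
  shows "smooth_solution \<omega> (rotating_wave \<omega> n \<kappa> f)"
proof -
  let ?e = "axis 3 1 :: real^3"
  define B where "B t x = rot n ((- \<kappa> / 3) * t) (rot ?e (\<omega> * t) x)" for t x
  \<comment> \<open>The axis n seen from the fixed frame: at time t the linear part is a multiple of
    m t \<bullet> x.\<close>
  define m where "m t = rot ?e (- (\<omega> * t)) n" for t
  have e: "norm ?e = 1" by simp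
  have B: "orthogonal_transformation (B t)" for t
    using orthogonal_transformation_compose[OF orthogonal_transformation_rot[OF n] orthogonal_transformation_rot[OF e]]
    by (simp add: B_def[abs_def] o_def)
  have rm: "rot ?e (\<omega> * t) (m t) = n" for t
    by (simp add: m_def rot_add[OF e])
  have m: "n \<bullet> rot ?e (\<omega> * t) x = m t \<bullet> x" for t x
    using inner_rot_rot[OF e, of "\<omega> * t" "m t" x] by (simp add: rm)
  define Q where "Q t x = f (B t x)" for t x
  define L where "L t x = m t \<bullet> x" for t x
  \<comment> \<open>The factor 1 makes this an instance of the lemmas on linear
    combinations.\<close>
  have z: "rotating_wave \<omega> n \<kappa> f t = (\<lambda>x. \<kappa> * L t x + 1 * Q t x)" for t
    by (simp add: fun_eq_iff rotating_wave_def Q_def L_def B_def m)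
  have sQ: "smooth_on S2 (Q t)" for t
    unfolding Q_def[abs_def] by (rule smooth_on_orthogonal[OF B f(1)])
  have sL: "smooth_on S2 (L t)" for t
    unfolding L_def[abs_def] by (rule smooth_on_linear[OF bounded_linear_inner_right])
  have BS: "B t x \<in> S2" if "x \<in> S2" for t x
    using that orthogonal_transformation_norm[OF B] by simp
  have lQ: "laplace_beltrami (Q t) x = - 6 * Q t x" if "x \<in> S2" for t x
    using laplace_beltrami_orthogonal[OF B f(1) that, of t] f(2)[OF BS[OF that, of t]]
    unfolding Q_def[abs_def] by linarith
  have lL: "laplace_beltrami (L t) x = - 2 * L t x" if "x \<in> S2" for t x
    using laplace_beltrami_linear[OF that] by (simp add: L_def[abs_def])
  have zm: "zero_mean (\<lambda>x. a * L t x + b * Q t x)" for a b t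
    by (intro zero_mean_lincomb smooth_on_imp_continuous_on sQ sL
        zero_mean_eigenfunction[OF sQ lQ] zero_mean_eigenfunction[OF sL lL]) auto
  have G: "\<G> (rotating_wave \<omega> n \<kappa> f t) y = (\<kappa> / 2) * L t y + (1 / 6) * Q t y" if "y \<in> S2" for t y
  proof -
    have "\<G> (rotating_wave \<omega> n \<kappa> f t) = restrict (\<lambda>y. (\<kappa> / 2) * L t y + (1 / 6) * Q t y) S2"
      unfolding z
    proof (rule \<G>_eqI)
      show "- laplace_beltrami (\<lambda>y. (\<kappa> / 2) * L t y + (1 / 6) * Q t y) x = \<kappa> * L t x + 1 * Q t x"
        if "x \<in> S2" for x
        unfolding laplace_beltrami_lincomb[OF sL sQ that] lL[OF that] lQ[OF that] by simp
    qed (rule smooth_on_lincomb[OF sL sQ] zm)+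
    then show ?thesis using that by simp
  qed
  have smooth: "smooth_on (S2 \<times> {0..}) (\<lambda>(x, t). rotating_wave \<omega> n \<kappa> f t x)"
  \<comment> \<open>Replacing \<open>f\<close> by its radial extension makes the formula meaningful
    and smooth for all nonzero x and all real times.\<close>
  proof (rule smooth_onI[of "(-{0}) \<times> UNIV"])
    let ?U = "(-{0}) \<times> (UNIV :: real set) :: ((real^3) \<times> real) set"
    have U: "open ?U" by (intro open_Times) auto
    show "open ?U" by (rule U)
    fix k
    have lin: "C_k_on k (\<lambda>z. c * snd z) ?U" for c :: real
      by (intro C_k_on_linear[OF U] bounded_linear_compose[OF bounded_linear_mult_right bounded_linear_snd])
    have f1: "C_k_on k (\<lambda>z. fst z \<bullet> v) ?U" for v :: "real^3"
      by (intro C_k_on_linear[OF U] bounded_linear_compose[OF bounded_linear_inner_left bounded_linear_fst])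
    have r1: "C_k_on k (\<lambda>z. rot ?e (\<omega> * snd z) (fst z) \<bullet> v) ?U" for v
      by (rule C_k_on_rot[OF U lin f1])
    have r2: "C_k_on k (\<lambda>z. B (snd z) (fst z) \<bullet> v) ?U" for v
      unfolding B_def by (rule C_k_on_rot[OF U lin r1])
    have r3: "C_k_on k (\<lambda>z. radial_ext f (B (snd z) (fst z))) ?U"
    proof (rule C_k_on_compose[OF U _ _ C_k_on_radial_ext[OF f(1)] r2])
      show "(\<lambda>z. B (snd z) (fst z)) ` ?U \<subseteq> - {0}"
      proof (rule image_subsetI)
        show "B (snd z) (fst z) \<in> - {0}" if "z \<in> ?U" for z
          using orthogonal_transformation_nonzero[OF B, of "fst z" "snd z"] that by auto
      qed
    qed auto
    show "C_k_on k (\<lambda>z. \<kappa> * (rot ?e (\<omega> * snd z) (fst z) \<bullet> n) + radial_ext f (B (snd z) (fst z))) ?U"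
      by (intro C_k_on_add[OF U] C_k_on_mult[OF U] C_k_on_const r1 r3)
  next
    fix z assume "z \<in> S2 \<times> {0::real..}"
    then show "\<kappa> * (rot ?e (\<omega> * snd z) (fst z) \<bullet> n) + radial_ext f (B (snd z) (fst z))
       = (\<lambda>(x, t). rotating_wave \<omega> n \<kappa> f t x) z"
      using BS by (cases z) (auto simp: rotating_wave_def B_def inner_commute)
  qed auto
  have "deriv (\<lambda>s. rotating_wave \<omega> n \<kappa> f s x) t
      + J x (grad (\<lambda>y. \<omega> * y $ 3 - \<G> (rotating_wave \<omega> n \<kappa> f t) y) x) \<bullet> grad (rotating_wave \<omega> n \<kappa> f t) x = 0"
    if x: "x \<in> S2" for x t
  proof -
    have x0: "x \<noteq> 0" using x by auto
    define q where "q = grad (Q t) x"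
    \<comment> \<open>The vector of the linear part of \<omega> x_3 - \<open>\<G>\<close> \<zeta>;
      the coefficient 1/2 is the inverse eigenvalue.\<close>
    define w where "w = \<omega> *\<^sub>R ?e - (\<kappa> / 2) *\<^sub>R m t"
    have q: "q \<bullet> v = grad f (B t x) \<bullet> B t v" for v
      unfolding q_def Q_def[abs_def] grad_orthogonal[OF B f(1) x0]
      by (rule adjoint_clauses[OF orthogonal_transformation_linear[OF B]])
    have gl: "grad (\<lambda>y. l \<bullet> y) x = l - (l \<bullet> x) *\<^sub>R x" for l
      by (rule grad_eq_tangential_part[OF x]) (auto intro!: derivative_eq_intros)
    have g1: "grad (rotating_wave \<omega> n \<kappa> f t) x = \<kappa> *\<^sub>R (m t - (m t \<bullet> x) *\<^sub>R x) + q"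
      unfolding z grad_lincomb[OF sL sQ x0] by (simp add: L_def[abs_def] gl q_def)
    have sw: "smooth_on S2 (\<lambda>y. w \<bullet> y)" by (rule smooth_on_linear[OF bounded_linear_inner_right])
    have "grad (\<lambda>y. \<omega> * y $ 3 - \<G> (rotating_wave \<omega> n \<kappa> f t) y) x = grad (\<lambda>y. 1 * (w \<bullet> y) + (- 1 / 6) * Q t y) x"
      by (rule grad_cong[OF smooth_on_lincomb[OF sw sQ] _ x0])
         (simp add: G w_def L_def inner_diff_left inner_3 axis_3_components algebra_simps)
    then have g2: "grad (\<lambda>y. \<omega> * y $ 3 - \<G> (rotating_wave \<omega> n \<kappa> f t) y) x = w - (w \<bullet> x) *\<^sub>R x - (1 / 6) *\<^sub>R q"
      unfolding grad_lincomb[OF sw sQ x0] by (simp add: gl q_def)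
    \<comment> \<open>Products of m with m and of q with q vanish. The mixed ones contribute
      -\<kappa>/2 and +\<kappa>/6, by antisymmetry, and so -\<kappa>/3.\<close>
    have "J x (w - (w \<bullet> x) *\<^sub>R x - (1 / 6) *\<^sub>R q) \<bullet> (\<kappa> *\<^sub>R (m t - (m t \<bullet> x) *\<^sub>R x) + q)
        = \<kappa> * \<omega> * (cross3 x ?e \<bullet> m t) + cross3 x (\<omega> *\<^sub>R ?e - (\<kappa> / 3) *\<^sub>R m t) \<bullet> q"
    proof -
      have "cross3 x q \<bullet> m t = - (cross3 x (m t) \<bullet> q)" by (simp add: inner_3 cross_components algebra_simps)
      then show ?thesis
        unfolding J_def w_def
        by (simp add: cross3_linear cross_refl inner_diff_left inner_diff_right inner_add_right dot_cross_self algebra_simps)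
    qed
    note J = this
    have dE: "((\<lambda>s. rot ?e (\<omega> * s) x) has_vector_derivative rot ?e (\<omega> * t) (\<omega> *\<^sub>R cross3 ?e x)) (at t)"
      using has_vector_derivative_rot[OF e has_vector_derivative_const[of x], of \<omega>] by simp
    have E: "cross3 n (rot ?e (\<omega> * t) x) = rot ?e (\<omega> * t) (cross3 (m t) x)"
      by (simp add: rot_cross3[OF e] rm)
    have "((\<lambda>s. B s x) has_vector_derivative
       rot n ((- \<kappa> / 3) * t) ((- \<kappa> / 3) *\<^sub>R cross3 n (rot ?e (\<omega> * t) x) + rot ?e (\<omega> * t) (\<omega> *\<^sub>R cross3 ?e x))) (at t)"
      unfolding B_def by (rule has_vector_derivative_rot[OF n dE])
    also have "rot n ((- \<kappa> / 3) * t) ((- \<kappa> / 3) *\<^sub>R cross3 n (rot ?e (\<omega> * t) x) + rot ?e (\<omega> * t) (\<omega> *\<^sub>R cross3 ?e x))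
      = B t ((- \<kappa> / 3) *\<^sub>R cross3 (m t) x + \<omega> *\<^sub>R cross3 ?e x)"
      unfolding B_def E by (simp only: linear_add[OF linear_rot[of ?e]] linear_scale[OF linear_rot[of ?e]])
    also have "(- \<kappa> / 3) *\<^sub>R cross3 (m t) x + \<omega> *\<^sub>R cross3 ?e x = - cross3 x (\<omega> *\<^sub>R ?e - (\<kappa> / 3) *\<^sub>R m t)"
      by (simp add: cross_skew[of _ x] cross3_linear)
    finally have dB: "((\<lambda>s. B s x) has_vector_derivative B t (- cross3 x (\<omega> *\<^sub>R ?e - (\<kappa> / 3) *\<^sub>R m t))) (at t)" .
    have "B t x \<noteq> 0" using orthogonal_transformation_nonzero[OF B x0] .
    from vector_derivative_diff_chain_within[OF dB has_derivative_at_withinI[OF has_derivative_radial_ext[OF f(1) this]]]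
    have "((\<lambda>s. f (B s x)) has_vector_derivative - (cross3 x (\<omega> *\<^sub>R ?e - (\<kappa> / 3) *\<^sub>R m t) \<bullet> q)) (at t)"
      using BS[OF x] by (simp add: o_def q[symmetric] inner_commute)
    moreover have "((\<lambda>s. n \<bullet> rot ?e (\<omega> * s) x) has_vector_derivative - \<omega> * (cross3 x ?e \<bullet> m t)) (at t)"
    proof -
      have "n \<bullet> rot ?e (\<omega> * t) (\<omega> *\<^sub>R cross3 ?e x) = - \<omega> * (cross3 x ?e \<bullet> m t)"
        unfolding m by (simp add: cross_skew[of ?e] inner_commute)
      then show ?thesis
        using bounded_linear.has_vector_derivative[OF bounded_linear_inner_right dE, of n] by simp
    qed
    ultimately have "((\<lambda>s. rotating_wave \<omega> n \<kappa> f s x) has_vector_derivative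
       \<kappa> * (- \<omega> * (cross3 x ?e \<bullet> m t)) - (cross3 x (\<omega> *\<^sub>R ?e - (\<kappa> / 3) *\<^sub>R m t) \<bullet> q)) (at t)"
      unfolding rotating_wave_def B_def has_real_derivative_iff_has_vector_derivative[symmetric]
      by (auto intro!: derivative_eq_intros)
    then have "deriv (\<lambda>s. rotating_wave \<omega> n \<kappa> f s x) t
      = \<kappa> * (- \<omega> * (cross3 x ?e \<bullet> m t)) - (cross3 x (\<omega> *\<^sub>R ?e - (\<kappa> / 3) *\<^sub>R m t) \<bullet> q)"
      by (intro DERIV_imp_deriv) (simp add: has_real_derivative_iff_has_vector_derivative)
    then show ?thesis unfolding g1 g2 J by simp
  qed
  then show ?thesis
    unfolding smooth_solution_def using smooth zm[of \<kappa> _ 1] by (simp add: z)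
qed


section \<open>Stable sets are invariant under rotations\<close>

lemma E2_D:
  assumes "Y \<in> E2"
  shows "Y \<in> extensional S2" "smooth_on S2 Y" "\<And>x. x \<in> S2 \<Longrightarrow> - laplace_beltrami Y x = 6 * Y x"
  using assms by (auto simp: E2_def)

text \<open>A half turn about n sends w to 2 (n \<bullet> w) n - w, so the bisector of two unit
  vectors is an axis exchanging them. Antipodal vectors have no bisector; there any axis orthogonal
  to w works.\<close>

lemma rot_pi_swap:
  assumes "norm u = 1" "norm w = 1"
  obtains n where "norm n = 1" "rot n pi w = (u::real^3)"
proof (cases "u = - w")
  case True
  obtain y :: "real^3" where y: "y \<noteq> 0" "orthogonal w y"
    using orthogonal_to_vector_exists[of w] by auto
  then have "norm (sgn y) = 1" "sgn y \<bullet> w = 0"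
    by (simp_all add: norm_sgn sgn_div_norm orthogonal_def inner_commute)
  then show ?thesis using that[of "sgn y"] True by (simp add: rot_def)
next
  case False
  define d where "d = u + w"
  have d: "d \<noteq> 0" using False by (simp add: d_def eq_neg_iff_add_eq_0)
  have 1: "u \<bullet> u = 1" "w \<bullet> w = 1" using assms by (simp_all add: norm_eq_1)
  then have dd: "d \<bullet> d = 2 * (d \<bullet> w)" by (simp add: d_def inner_add_left inner_add_right inner_commute)
  define n where "n = d /\<^sub>R norm d"
  have "norm n = 1" using d by (simp add: n_def)
  moreover have "(2 * (n \<bullet> w)) *\<^sub>R n = d"
  proof -
    have "(2 * (n \<bullet> w)) *\<^sub>R n = (2 * (d \<bullet> w) / (norm d * norm d)) *\<^sub>R d" by (simp add: n_def divide_inverse mult_ac)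
    also have "2 * (d \<bullet> w) = norm d * norm d"
      using dd by (simp add: power2_norm_eq_inner[symmetric] power2_eq_square)
    also have "(norm d * norm d / (norm d * norm d)) *\<^sub>R d = d" using d by simp
    finally show ?thesis .
  qed
  then have "rot n pi w = u" by (simp add: rot_def d_def)
  ultimately show ?thesis using that by blast
qed

text \<open>The image of e_1 is horizontal and gives the angle. Compatibility with the cross product
  encodes the orientation and forces the image of e_2 = e_3 x e_1.\<close>

lemma rotation_fixing_axis_3:
  assumes D: "orthogonal_transformation D" "\<And>x y. D (cross3 x y) = cross3 (D x) (D y)"
    and fixed: "D (axis 3 1) = axis 3 1"
  obtains b where "\<And>x. D x = rot (axis 3 1) b x"
proof -
  define v where "v = D (axis 1 1)"
  have "v \<bullet> axis 3 1 = D (axis 1 1) \<bullet> D (axis 3 1)" by (simp add: v_def fixed)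
  also have "\<dots> = 0" using D(1) by (simp add: orthogonal_transformation_def inner_3 axis_3_components)
  finally have v3: "v $ 3 = 0" by (simp add: inner_3 axis_3_components)
  have "norm v = 1" using orthogonal_transformation_norm[OF D(1)] by (simp add: v_def)
  then have "(v $ 1)\<^sup>2 + (v $ 2)\<^sup>2 = 1" using v3 by (simp add: norm_eq_1 inner_3 power2_eq_square)
  then obtain b where b: "v $ 1 = cos b" "v $ 2 = sin b" using sincos_total_2pi by blast
  have 1: "D (axis 1 1) = rot (axis 3 1) b (axis 1 1)"
    using b v3 by (simp add: v_def[symmetric] rot_def vec_eq_3 cross_components inner_3 axis_3_components)
  have r3: "rot (axis 3 1) b (axis 3 1) = axis 3 1"
    by (simp add: rot_def vec_eq_3 cross_components inner_3 axis_3_components)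
  have "D (axis 2 1) = cross3 (D (axis 3 1)) (D (axis 1 1))"
    unfolding D(2)[symmetric] cross_basis ..
  also have "\<dots> = cross3 (rot (axis 3 1) b (axis 3 1)) (rot (axis 3 1) b (axis 1 1))"
    unfolding 1 r3 fixed ..
  also have "\<dots> = rot (axis 3 1) b (axis 2 1)"
    by (subst rot_cross3[symmetric]) (simp_all add: cross_basis)
  finally have 2: "D (axis 2 1) = rot (axis 3 1) b (axis 2 1)" .
  have "D x = rot (axis 3 1) b x" for x
  proof (rule fun_cong[OF linear_eq_stdbasis[OF orthogonal_transformation_linear[OF D(1)] linear_rot]])
    fix e :: "real^3" assume "e \<in> Basis"
    then obtain i where "e = axis i 1" by (auto simp: Basis_vec_def)
    then show "D e = rot (axis 3 1) b e" using exhaust_3[of i] 1 2 r3 fixed by auto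
  qed
  then show ?thesis using that by blast
qed

text \<open>A half turn taking e_3 to C e_3 is its own inverse, so composing it with C leaves a
  rotation fixing e_3. Thus invariance under each \<open>rot\<close> suffices for all of
  SO(3).\<close>

lemma rotation_matrix_decomposition:
  assumes C: "rotation_matrix C"
  obtains n b where "norm n = 1" "\<And>x. C *v x = rot n pi (rot (axis 3 1) b x)"
proof -
  have oC: "orthogonal_transformation (\<lambda>x. C *v x)"
    using C by (simp add: rotation_matrix_def orthogonal_transformation_matrix matrix_of_matrix_vector_mul)
  obtain n where n: "norm n = 1" "rot n pi (axis 3 1) = C *v axis 3 1"
    using rot_pi_swap[of "C *v axis 3 1" "axis 3 1"] orthogonal_transformation_norm[OF oC] by auto
  have inv: "rot n pi (rot n pi x) = x" for x
    unfolding rot_add[OF n(1)] by (simp add: rot_def)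
  define D where "D x = rot n pi (C *v x)" for x
  have "orthogonal_transformation D"
    using orthogonal_transformation_compose[OF orthogonal_transformation_rot[OF n(1)] oC] by (simp add: D_def[abs_def] o_def)
  moreover have "D (cross3 x y) = cross3 (D x) (D y)" for x y
    by (simp add: D_def rot_cross3[OF n(1), symmetric] cross_rotation_matrix[OF C])
  moreover have "D (axis 3 1) = axis 3 1" by (simp add: D_def n(2)[symmetric] inv)
  ultimately obtain b where b: "\<And>x. D x = rot (axis 3 1) b x"
    using rotation_fixing_axis_3[of D] by blast
  have "C *v x = rot n pi (rot (axis 3 1) b x)" for x
    unfolding b[symmetric] D_def inv ..
  then show ?thesis using that n(1) by blast
qed

section \<open>L^p estimates and compactness\<close>

lemma continuous_on_abs_powr:
  fixes f :: "real^3 \<Rightarrow> real"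
  assumes "0 < p" "continuous_on S2 f"
  shows "continuous_on S2 (\<lambda>x. \<bar>f x\<bar> powr p)"
  by (rule continuous_on_powr') (use assms in \<open>auto intro!: continuous_intros\<close>)

lemma Lp_norm_nonneg: "Lp_norm p f \<ge> 0"
  by (simp add: Lp_norm_def)

lemma Lp_norm_cong: "(\<And>x. x \<in> S2 \<Longrightarrow> \<bar>f x\<bar> = \<bar>g x\<bar>) \<Longrightarrow> Lp_norm p f = Lp_norm p g"
  unfolding Lp_norm_def by (intro arg_cong2[where f = "(powr)"] Bochner_Integration.integral_cong) (auto simp: space_area_measure)

lemma continuous_on_imp_Lp:
  assumes "0 < p" "continuous_on S2 f"
  shows "f \<in> Lp p"
  using area_integral(1)[OF continuous_on_abs_powr[OF assms]] measurable_area_measure[OF assms(2)]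
  by (simp add: Lp_def)

lemma Lp_norm_eq_0_imp:
  assumes "0 < p" "continuous_on S2 f" "Lp_norm p f = 0" "x \<in> S2"
  shows "f x = 0"
  using area_integral_nonneg_eq_0[OF continuous_on_abs_powr[OF assms(1,2)] _ _ assms(4)] assms(3)
  by (simp add: Lp_norm_def)

text \<open>A crude substitute for Minkowski's inequality.\<close>

lemma Lp_norm_add_le:
  assumes p: "1 < p" and f: "continuous_on S2 f" and g: "continuous_on S2 g"
  shows "Lp_norm p (\<lambda>x. f x + g x) \<le> 4 * (Lp_norm p f + Lp_norm p g)"
proof -
  have p0: "0 < p" using p by simp
  let ?I = "\<lambda>f. \<integral>x. \<bar>f x\<bar> powr p \<partial>area_measure"
  have int: "integrable area_measure (\<lambda>x. \<bar>f x\<bar> powr p)" if "continuous_on S2 f" for f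
    by (rule area_integral(1)[OF continuous_on_abs_powr[OF p0 that]])
  have pw: "\<bar>a + b\<bar> powr p \<le> 2 powr p * (\<bar>a\<bar> powr p + \<bar>b\<bar> powr p)" for a b :: real
  proof -
    have "\<bar>a + b\<bar> powr p \<le> (2 * max \<bar>a\<bar> \<bar>b\<bar>) powr p" using p by (intro powr_mono2) auto
    also have "\<dots> = 2 powr p * (max \<bar>a\<bar> \<bar>b\<bar>) powr p" by (simp add: powr_mult)
    also have "(max \<bar>a\<bar> \<bar>b\<bar>) powr p \<le> \<bar>a\<bar> powr p + \<bar>b\<bar> powr p" by (simp add: max_def)
    finally show ?thesis by simp
  qed
  define M where "M = max (?I f) (?I g)"
  have "?I (\<lambda>x. f x + g x) \<le> (\<integral>x. 2 powr p * (\<bar>f x\<bar> powr p + \<bar>g x\<bar> powr p) \<partial>area_measure)"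
    using pw by (intro integral_mono int continuous_intros f g Bochner_Integration.integrable_mult_right Bochner_Integration.integrable_add) auto
  also have "\<dots> = 2 powr p * (?I f + ?I g)"
    using int[OF f] int[OF g] by simp
  \<comment> \<open>The factor 2 is enlarged to \<open>2 powr p\<close> on purpose: the p-th root of
    the total constant is then 4 for every p.\<close>
  also have "\<dots> \<le> 2 powr p * (2 powr p * M)"
  proof (rule mult_left_mono)
    have "?I f + ?I g \<le> 2 * M" by (simp add: M_def)
    also have "\<dots> \<le> 2 powr p * M"
      using p powr_mono[of 1 p 2] by (intro mult_right_mono) (auto simp: M_def le_max_iff_disj)
    finally show "?I f + ?I g \<le> 2 powr p * M" .
  qed simp
  finally have "Lp_norm p (\<lambda>x. f x + g x) \<le> (2 powr p * (2 powr p * M)) powr (1 / p)"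
    unfolding Lp_norm_def using p by (intro powr_mono2) auto
  also have "\<dots> = 4 * M powr (1 / p)"
    using p by (simp add: powr_mult powr_powr M_def le_max_iff_disj)
  also have "M powr (1 / p) \<le> Lp_norm p f + Lp_norm p g"
    by (simp add: M_def Lp_norm_def max_def)
  finally show ?thesis by simp
qed

lemma Lp_norm_le_sup:
  assumes "0 < p" "continuous_on S2 f" "\<And>x. x \<in> S2 \<Longrightarrow> \<bar>f x\<bar> \<le> c" "0 \<le> c"
  shows "Lp_norm p f \<le> c * measure area_measure (space area_measure) powr (1 / p)"
proof -
  interpret finite_measure area_measure by (rule finite_measure_area)
  have "(\<integral>x. \<bar>f x\<bar> powr p \<partial>area_measure) \<le> (\<integral>x. c powr p \<partial>area_measure)"
    using assms by (intro integral_mono area_integral(1)[OF continuous_on_abs_powr]) (auto intro!: powr_mono2 simp: space_area_measure)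
  then have "Lp_norm p f \<le> (measure area_measure (space area_measure) * c powr p) powr (1 / p)"
    unfolding Lp_norm_def using assms(1) by (intro powr_mono2) auto
  also have "\<dots> = c * measure area_measure (space area_measure) powr (1 / p)"
    using assms(1,4) by (simp add: powr_mult powr_powr)
  finally show ?thesis .
qed

text \<open>If no member equals g on the sphere, each has positive distance from g by continuity,
  and finitely many balls that stay away from g cover X; so X as a whole stays away from g.\<close>

lemma compactin_Lp_limit:
  assumes p: "1 < p" and X: "compactin (Lp_topology p) X" "\<And>f. f \<in> X \<Longrightarrow> continuous_on S2 f"
    and g: "continuous_on S2 g" and lim: "\<And>\<epsilon>. \<epsilon> > 0 \<Longrightarrow> \<exists>h\<in>X. Lp_norm p (\<lambda>x. h x - g x) < \<epsilon>"
  shows "\<exists>f\<in>X. \<forall>x\<in>S2. f x = g x"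
proof (rule ccontr)
  assume neg: "\<not> ?thesis"
  have p0: "0 < p" using p by simp
  define r where "r f = Lp_norm p (\<lambda>x. f x - g x)" for f
  have r: "r f > 0" if f: "f \<in> X" for f
  proof (rule ccontr)
    assume "\<not> r f > 0"
    then have "r f = 0" using Lp_norm_nonneg[of p "\<lambda>x. f x - g x"] unfolding r_def by linarith
    then have "f x - g x = 0" if "x \<in> S2" for x
      using Lp_norm_eq_0_imp[OF p0, of "\<lambda>x. f x - g x"] X(2)[OF f] g that by (auto simp: r_def intro!: continuous_intros)
    then show False using neg f by auto
  qed
  \<comment> \<open>The radius is an eighth of the distance: two such terms, enlarged by the
    constant 4 of the triangle inequality, just stay below \<open>r f\<close>.\<close>
  define U where "U f = {h \<in> Lp p. Lp_norm p (\<lambda>x. h x - f x) < r f / 8}" for f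
  have op: "openin (Lp_topology p) (U f)" if "f \<in> X" for f
    unfolding Lp_topology_def U_def
    using continuous_on_imp_Lp[OF p0 X(2)[OF that]] by (intro topology_generated_by_Basis) blast
  have "f \<in> U f" if "f \<in> X" for f
    using r[OF that] continuous_on_imp_Lp[OF p0 X(2)[OF that]] by (simp add: U_def Lp_norm_def)
  then have cover: "X \<subseteq> \<Union> (U ` X)" by blast
  have "\<exists>\<F>. finite \<F> \<and> \<F> \<subseteq> U ` X \<and> X \<subseteq> \<Union>\<F>"
    by (rule compactinD[OF X(1) _ cover]) (use op in auto)
  then obtain \<F> where F: "finite \<F>" "\<F> \<subseteq> U ` X" "X \<subseteq> \<Union>\<F>" by blast
  then obtain X0 where X0: "finite X0" "X0 \<subseteq> X" "\<F> = U ` X0"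
    using finite_subset_image[OF F(1,2)] by blast
  \<comment> \<open>Inserting 1 keeps the set nonempty without a separate argument.\<close>
  define \<delta> where "\<delta> = Min (insert 1 ((\<lambda>f. r f / 8) ` X0))"
  have "\<delta> > 0" unfolding \<delta>_def using X0 r by (subst Min_gr_iff) auto
  then obtain h where h: "h \<in> X" "Lp_norm p (\<lambda>x. h x - g x) < \<delta>" using lim by blast
  then obtain f where f: "f \<in> X0" "h \<in> U f" using F(3) X0(3) by blast
  then have fX: "f \<in> X" using X0(2) by blast
  have "\<delta> \<le> r f / 8" unfolding \<delta>_def using X0(1) f(1) by (intro Min_le) auto
  have "Lp_norm p (\<lambda>x. f x - h x) = Lp_norm p (\<lambda>x. h x - f x)"
    by (rule Lp_norm_cong) (simp add: abs_minus_commute)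
  then have 1: "Lp_norm p (\<lambda>x. f x - h x) < r f / 8" using f(2) by (simp add: U_def)
  have "r f = Lp_norm p (\<lambda>x. (f x - h x) + (h x - g x))" by (simp add: r_def)
  also have "\<dots> \<le> 4 * (Lp_norm p (\<lambda>x. f x - h x) + Lp_norm p (\<lambda>x. h x - g x))"
    by (intro Lp_norm_add_le p continuous_intros X(2) fX h g)
  also have "\<dots> < r f" using 1 h(2) \<open>\<delta> \<le> r f / 8\<close> by argo
  finally show False by simp
qed

text \<open>At such a time the rotation caused by \<omega> is the identity and only the turn about n
  remains. Arbitrarily late times are required because that turn is slow.\<close>

lemma rot_full_turn_time:
  fixes \<omega> M :: real
  obtains T where "T > 0" "T \<ge> M" "\<And>n x. rot n (\<omega> * T) x = x"
proof (cases "\<omega> = 0")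
  case True
  then show ?thesis using that[of "max 1 M"] by simp
next
  case False
  obtain k :: nat where k: "M * \<bar>\<omega>\<bar> < real k" using reals_Archimedean2 by blast
  \<comment> \<open>\<open>k\<close> may be 0 when \<open>M\<close> is negative; k + 1 turns keep
    the time positive.\<close>
  define \<theta> where "\<theta> = 2 * real (k + 1) * pi"
  have \<theta>: "cos \<theta> = 1" "sin \<theta> = 0"
    unfolding \<theta>_def by (rule cos_2npi, rule sin_2npi)
  define T where "T = \<theta> / \<bar>\<omega>\<bar>"
  have "real (k + 1) * 1 \<le> real (k + 1) * (2 * pi)"
    by (rule mult_left_mono) (use pi_ge_two in auto)
  then have "real k \<le> \<theta>" by (simp add: \<theta>_def mult_ac)
  then have "M \<le> T" using k False by (simp add: T_def pos_le_divide_eq)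
  moreover have "T > 0" using False by (simp add: T_def \<theta>_def)
  moreover have "rot n (\<omega> * T) x = x" for n x
  proof -
    have "\<omega> * T = \<theta> \<or> \<omega> * T = - \<theta>" using False by (simp add: T_def abs_if)
    then have "cos (\<omega> * T) = 1" "sin (\<omega> * T) = 0" using \<theta> by auto
    then show ?thesis by (simp add: rot_def)
  qed
  ultimately show ?thesis using that by blast
qed

definition Lp_stable :: "real \<Rightarrow> real \<Rightarrow> (real^3 \<Rightarrow> real) set \<Rightarrow> bool" where
  "Lp_stable p \<omega> X \<longleftrightarrow> (\<forall>\<epsilon>>0. \<exists>\<delta>>0. \<forall>\<zeta>. smooth_solution \<omega> \<zeta> \<longrightarrow>
     Lp_dist p X (\<zeta> 0) < \<delta> \<longrightarrow> (\<forall>t>0. Lp_dist p X (\<zeta> t) < \<epsilon>))"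

text \<open>Adding to \<open>f\<close> a small multiple of \<open>x \<mapsto> n \<bullet> x\<close> makes the solution rotate slowly about the
  axis \<open>n\<close>; after a long time it has turned by any prescribed angle.\<close>

lemma Lp_stable_rot:
  assumes p: "1 < p" and X: "compactin (Lp_topology p) X" "X \<subseteq> E2" and st: "Lp_stable p \<omega> X"
    and n: "norm n = 1" and f: "f \<in> X"
  shows "(\<lambda>x\<in>S2. f (rot n \<alpha> x)) \<in> X"
proof -
  have p0: "0 < p" using p by simp
  have sm: "smooth_on S2 h" if "h \<in> X" for h by (rule E2_D(2)[OF subsetD[OF X(2) that]])
  have cX: "continuous_on S2 h" if "h \<in> X" for h
    by (rule smooth_on_imp_continuous_on[OF sm[OF that]])
  have eig: "- laplace_beltrami f x = 6 * f x" if "x \<in> S2" for x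
    by (rule E2_D(3)[OF subsetD[OF X(2) f] that])
  define g where "g x = f (rot n \<alpha> x)" for x
  have cg: "continuous_on S2 g"
    unfolding g_def
    by (rule smooth_on_imp_continuous_on[OF smooth_on_orthogonal[OF orthogonal_transformation_rot[OF n] sm[OF f]]])
  define K where "K = measure area_measure (space area_measure) powr (1 / p)"
  have K: "K \<ge> 0" by (simp add: K_def)
  have small: "Lp_norm p (\<lambda>x. \<kappa> * (n \<bullet> x)) \<le> \<bar>\<kappa>\<bar> * K" for \<kappa>
    unfolding K_def
  proof (rule Lp_norm_le_sup[OF p0])
    show "\<bar>\<kappa> * (n \<bullet> x)\<bar> \<le> \<bar>\<kappa>\<bar>" if "x \<in> S2" for x
      using mult_left_mono[of "\<bar>n \<bullet> x\<bar>" 1 "\<bar>\<kappa>\<bar>"] Cauchy_Schwarz_ineq2[of n x] n that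
      by (simp add: abs_mult)
  qed (auto intro!: continuous_intros)
  have "\<exists>h\<in>X. Lp_norm p (\<lambda>x. h x - g x) < \<epsilon>" if \<epsilon>: "\<epsilon> > 0" for \<epsilon>
  proof -
    \<comment> \<open>Again \<epsilon>/8 allows for two error terms and the constant 4.\<close>
    obtain \<delta> where \<delta>: "\<delta> > 0" "\<And>\<zeta> t. smooth_solution \<omega> \<zeta> \<Longrightarrow> Lp_dist p X (\<zeta> 0) < \<delta> \<Longrightarrow> t > 0 \<Longrightarrow> Lp_dist p X (\<zeta> t) < \<epsilon> / 8"
      using st \<epsilon> unfolding Lp_stable_def by (metis divide_pos_pos zero_less_numeral)
    define \<eta> where "\<eta> = min \<delta> (\<epsilon> / 8)"
    have \<eta>: "\<eta> > 0" using \<delta>(1) \<epsilon> by (simp add: \<eta>_def)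
    \<comment> \<open>The bound makes |\<kappa>| K = 3 |\<alpha>| K / T smaller than \<eta>; the
      summand 1 makes the inequality strict.\<close>
    obtain T where T: "T > 0" "T \<ge> (3 * \<bar>\<alpha>\<bar> * K + 1) / \<eta>" "\<And>n x. rot n (\<omega> * T) x = x"
      using rot_full_turn_time by blast
    \<comment> \<open>Chosen so that the angle (-\<kappa>/3) T reached at time T is exactly
      \<alpha>.\<close>
    define \<kappa> where "\<kappa> = - 3 * \<alpha> / T"
    have "\<bar>\<kappa>\<bar> * K * T < \<eta> * T"
      using T(1,2) \<eta> by (simp add: \<kappa>_def pos_divide_le_eq mult.commute abs_mult)
    then have \<kappa>: "\<bar>\<kappa>\<bar> * K < \<eta>" using T(1) by simp
    let ?\<zeta> = "rotating_wave \<omega> n \<kappa> f"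
    have sol: "smooth_solution \<omega> ?\<zeta>" by (rule smooth_solution_rotating_wave[OF n sm[OF f] eig])
    have dist: "Lp_dist p X h \<le> Lp_norm p (\<lambda>x. f x - h x)" for h
      unfolding Lp_dist_def using f Lp_norm_nonneg by (intro cINF_lower) (auto intro!: bdd_belowI[of _ 0])
    have "Lp_norm p (\<lambda>x. f x - ?\<zeta> 0 x) = Lp_norm p (\<lambda>x. \<kappa> * (n \<bullet> x))"
      by (rule Lp_norm_cong) (simp add: rotating_wave_def)
    then have "Lp_dist p X (?\<zeta> 0) < \<delta>"
      using dist[of "?\<zeta> 0"] small[of \<kappa>] \<kappa> by (simp add: \<eta>_def)
    from \<delta>(2)[OF sol this T(1)] obtain h where h: "h \<in> X" "Lp_norm p (\<lambda>x. h x - ?\<zeta> T x) < \<epsilon> / 8"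
      unfolding Lp_dist_def using f Lp_norm_nonneg by (subst (asm) cINF_less_iff) (auto intro!: bdd_belowI[of _ 0])
    have \<zeta>T: "?\<zeta> T x = \<kappa> * (n \<bullet> x) + g x" for x
      using T(1) by (simp add: rotating_wave_def T(3) g_def \<kappa>_def)
    have c\<zeta>: "continuous_on S2 (?\<zeta> T)"
      unfolding \<zeta>T[abs_def] by (intro continuous_intros cg)
    have "Lp_norm p (\<lambda>x. h x - g x) = Lp_norm p (\<lambda>x. (h x - ?\<zeta> T x) + \<kappa> * (n \<bullet> x))"
      by (simp add: \<zeta>T)
    also have "\<dots> \<le> 4 * (Lp_norm p (\<lambda>x. h x - ?\<zeta> T x) + Lp_norm p (\<lambda>x. \<kappa> * (n \<bullet> x)))"
      by (intro Lp_norm_add_le p continuous_intros cX h c\<zeta>)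
    also have "\<dots> < \<epsilon>" using h(2) small[of \<kappa>] \<kappa> by (simp add: \<eta>_def)
    finally show ?thesis using h(1) by blast
  qed
  then obtain h where h: "h \<in> X" "\<forall>x\<in>S2. h x = g x"
    using compactin_Lp_limit[OF p X(1) cX cg] by blast
  \<comment> \<open>Members of \<open>E2\<close> are extensional, so agreement on the sphere is
    equality.\<close>
  have "h = (\<lambda>x\<in>S2. f (rot n \<alpha> x))"
    using h(2) E2_D(1)[OF subsetD[OF X(2) h(1)]] by (auto simp: extensional_def restrict_def g_def fun_eq_iff)
  then show ?thesis using h(1) by simp
qed

text \<open>The Laplacian commutes with rotations. Orbit members are cut off outside the sphere,
  which \<open>laplace_beltrami_cong\<close> shows to be harmless.\<close>

lemma SO3_orbit_subset_E2:
  assumes "Y \<in> E2"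
  shows "SO3_orbit Y \<subseteq> E2"
proof
  fix f assume "f \<in> SO3_orbit Y"
  then obtain A :: "real^3^3" where A: "rotation_matrix A" and f: "f = (\<lambda>x\<in>S2. Y (A *v x))"
    unfolding SO3_orbit_def by blast
  have oA: "orthogonal_transformation (\<lambda>x. A *v x)"
    using A by (simp add: rotation_matrix_def orthogonal_transformation_matrix matrix_of_matrix_vector_mul)
  have Y: "smooth_on S2 Y" "\<And>x. x \<in> S2 \<Longrightarrow> - laplace_beltrami Y x = 6 * Y x"
    using E2_D[OF assms] by blast+
  have s: "smooth_on S2 (\<lambda>x. Y (A *v x))" by (rule smooth_on_orthogonal[OF oA Y(1)])
  have "- laplace_beltrami f x = 6 * f x" if x: "x \<in> S2" for x
  proof -
    have "A *v x \<in> S2" using x orthogonal_transformation_norm[OF oA] by simp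
    then have "- laplace_beltrami (\<lambda>x. Y (A *v x)) x = 6 * Y (A *v x)"
      unfolding laplace_beltrami_orthogonal[OF oA Y(1) x] by (rule Y(2))
    moreover have "laplace_beltrami f x = laplace_beltrami (\<lambda>x. Y (A *v x)) x"
      by (rule laplace_beltrami_cong[OF s _ x]) (simp add: f)
    ultimately show ?thesis using x by (simp add: f)
  qed
  moreover have "smooth_on S2 f" by (rule smooth_on_cong[OF s]) (simp add: f)
  ultimately show "f \<in> E2" by (simp add: E2_def f)
qed

theorem theorem8p2:
  fixes p \<omega> :: real and Y :: "real^3 \<Rightarrow> real"
  assumes "1 < p" and "Y \<in> E2" and "\<exists>x\<in>S2. Y x \<noteq> 0"
  shows "\<not> (\<exists>X. compactin (Lp_topology p) X \<and> X \<noteq> {} \<and> X \<subset> SO3_orbit Y \<and>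
    (\<forall>\<epsilon>>0. \<exists>\<delta>>0. \<forall>\<zeta>. smooth_solution \<omega> \<zeta> \<longrightarrow>
       Lp_dist p X (\<zeta> 0) < \<delta> \<longrightarrow> (\<forall>t>0. Lp_dist p X (\<zeta> t) < \<epsilon>)))"
proof
  assume "\<exists>X. compactin (Lp_topology p) X \<and> X \<noteq> {} \<and> X \<subset> SO3_orbit Y \<and>
    (\<forall>\<epsilon>>0. \<exists>\<delta>>0. \<forall>\<zeta>. smooth_solution \<omega> \<zeta> \<longrightarrow>
       Lp_dist p X (\<zeta> 0) < \<delta> \<longrightarrow> (\<forall>t>0. Lp_dist p X (\<zeta> t) < \<epsilon>))"
  then obtain X where X: "compactin (Lp_topology p) X" "X \<noteq> {}" "X \<subset> SO3_orbit Y" "Lp_stable p \<omega> X"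
    unfolding Lp_stable_def by blast
  have XE: "X \<subseteq> E2" using X(3) SO3_orbit_subset_E2[OF assms(2)] by blast
  note rot_closed = Lp_stable_rot[OF assms(1) X(1) XE X(4)]
  obtain f where f: "f \<in> X" using X(2) by blast
  then have "f \<in> SO3_orbit Y" using X(3) by blast
  then obtain A0 :: "real^3^3" where A0: "rotation_matrix A0" "f = (\<lambda>x\<in>S2. Y (A0 *v x))"
    unfolding SO3_orbit_def by blast
  have "SO3_orbit Y \<subseteq> X"
  proof
    fix g assume "g \<in> SO3_orbit Y"
    then obtain A :: "real^3^3" where A: "rotation_matrix A" "g = (\<lambda>x\<in>S2. Y (A *v x))"
      unfolding SO3_orbit_def by blast
    \<comment> \<open>The transpose is the inverse of \<open>A0\<close>, so \<open>C\<close> is the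
      rotation that carries f = Y o A0 to g = Y o A.\<close>
    define C where "C = transpose A0 ** A"
    have rC: "rotation_matrix C"
      using A(1) A0(1) by (simp add: C_def rotation_matrix_def orthogonal_matrix_mul orthogonal_matrix_transpose det_mul det_transpose)
    obtain n b where n: "norm n = 1" and C: "\<And>x. C *v x = rot n pi (rot (axis 3 1) b x)"
      using rotation_matrix_decomposition[OF rC] by blast
    have "A0 ** C = A"
      using A0(1) by (simp add: C_def matrix_mul_assoc rotation_matrix_def orthogonal_matrix_def)
    then have AC: "A0 *v rot n pi (rot (axis 3 1) b x) = A *v x" for x
      by (simp add: C[symmetric] matrix_vector_mul_assoc)
    have e: "norm (axis 3 1 :: real^3) = 1" by simp
    have S: "rot m a x \<in> S2" if "norm m = 1" "x \<in> S2" for m a x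
      using that orthogonal_transformation_norm[OF orthogonal_transformation_rot[OF that(1)]] by simp
    \<comment> \<open>Precomposition reverses the order: the outer factor, the half turn about n, is
      applied to f first.\<close>
    have "(\<lambda>x\<in>S2. (\<lambda>x\<in>S2. f (rot n pi x)) (rot (axis 3 1) b x)) \<in> X"
      by (rule rot_closed[OF e rot_closed[OF n f]])
    also have "(\<lambda>x\<in>S2. (\<lambda>x\<in>S2. f (rot n pi x)) (rot (axis 3 1) b x)) = g"
      unfolding A(2) A0(2) using S[OF n] S[OF e] AC by (intro restrict_ext) simp
    finally show "g \<in> X" .
  qed
  then show False using X(3) by blast
qed

end
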